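(* The twist map $\vartheta$ defines an involution on $\mathrm{Fl}_n^{\ge 0}$ and on $\mathrm{Fl}_n^{>0}$. That is, for $V\in\mathrm{Fl}_n^{\ge 0}$, represented by the unique orthogonal matrix $g$ whose left-justified minors are all nonnegative, the flag $\vartheta(V)$ represented by $\big((-1)^{i+j}g_{j,i}\big)_{1\le i,j\le n}$ again lies in $\mathrm{Fl}_n^{\ge 0}$, it lies in $\mathrm{Fl}_n^{>0}$ if $V\in\mathrm{Fl}_n^{>0}$, and $\vartheta(\vartheta(V))=V$.
   Context: $\mathrm{Fl}_n(\mathbb{C})=\mathrm{GL}_n(\mathbb{C})/\mathrm{B}_n(\mathbb{C})$ is the complete flag variety, where $\mathrm{B}_n(\mathbb{C})$ is the group of invertible upper-triangular matrices; a matrix $g$ represents the flag $(V_1,\dots,V_{n-1})$ with $V_k$ the span of the first $k$ columns of $g$. $\mathrm{GL}_n^{>0}$ is the set of real $n\times n$ matrices all of whose minors are positive. $\mathrm{Fl}_n^{>0}$ is the image of $\mathrm{GL}_n^{>0}$ in $\mathrm{Fl}_n(\mathbb{C})$, and $\mathrm{Fl}_n^{\ge 0}$ is its closure in the Euclidean topology. A left-justified minor of $g$ is a minor with row set $I$ and column set $\{1,\dots,|I|\}$. Every $V\in\mathrm{Fl}_n^{\ge 0}$ is represented by a unique real orthogonal $n\times n$ matrix $g$ all of whose left-justified minors are nonnegative. The twist map $\vartheta$ sends $V$ to the flag represented by $\delta_n g^{-1}\delta_n=((-1)^{i+j}g_{j,i})_{i,j}$, where $\delta_n=\mathrm{Diag}(1,-1,1,\dots,(-1)^{n-1})$.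 *)

theory Defs
  imports
    "Jordan_Normal_Form.Determinant"
    "Jordan_Normal_Form.DL_Submatrix"
    "HOL-Algebra.Coset"
    "HOL-Analysis.Function_Topology"
begin

text \<open>Matrices are indexed from \<open>0\<close>, so the parities of \<open>i + j\<close> and the entries
  \<open>1, -1, 1, \<dots>\<close> of \<open>\<delta>\<^sub>n\<close> are the same as for indices starting at \<open>1\<close>.\<close>

subsection \<open>The complete flag variety\<close>

definition GL :: "nat \<Rightarrow> complex mat monoid" where
  "GL n = units_of (ring_mat TYPE(complex) n ())"

definition Borel :: "nat \<Rightarrow> complex mat set" where
  "Borel n = {b \<in> carrier (GL n). upper_triangular b}"

text \<open>The point of \<open>GL\<^sub>n(\<complex>)/B\<^sub>n(\<complex>)\<close> represented by \<open>g\<close>, as the left coset \<open>g B\<^sub>n(\<complex>)\<close>. Right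
  multiplication by \<open>B\<^sub>n(\<complex>)\<close> is exactly the change of basis preserving the spans of the first
  \<open>k\<close> columns for all \<open>k\<close>.\<close>

definition flag :: "nat \<Rightarrow> complex mat \<Rightarrow> complex mat set" where
  "flag n g = g <#\<^bsub>GL n\<^esub> Borel n"

definition Fl :: "nat \<Rightarrow> complex mat set set" where
  "Fl n = flag n ` carrier (GL n)"

definition real_flag :: "nat \<Rightarrow> real mat \<Rightarrow> complex mat set" where
  "real_flag n g = flag n (map_mat complex_of_real g)"

text \<open>The Euclidean topology on \<open>GL\<^sub>n(\<complex>)\<close> is the one induced by the \<open>n\<^sup>2\<close> matrix entries; the
  Euclidean topology on \<open>Fl\<^sub>n(\<complex>)\<close> is its quotient topology.\<close>

definition GL_topology :: "nat \<Rightarrow> complex mat topology" where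
  "GL_topology n =
     pullback_topology (carrier (GL n))
       (\<lambda>A. restrict (\<lambda>ij. A $$ ij) ({..<n} \<times> {..<n}))
       (product_topology (\<lambda>_. euclidean) ({..<n} \<times> {..<n}))"

definition Fl_topology :: "nat \<Rightarrow> complex mat set topology" where
  "Fl_topology n = topology (\<lambda>U. U \<subseteq> Fl n \<and>
     openin (GL_topology n) {g \<in> carrier (GL n). flag n g \<in> U})"

lemma topspace_GL_topology: "topspace (GL_topology n) = carrier (GL n)"
  by (auto simp: GL_topology_def topspace_pullback_topology)

lemma openin_Fl_topology:
  "openin (Fl_topology n) U \<longleftrightarrow>
     U \<subseteq> Fl n \<and> openin (GL_topology n) {g \<in> carrier (GL n). flag n g \<in> U}"
proof -
  have "istopology (\<lambda>U. U \<subseteq> Fl n \<and>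
     openin (GL_topology n) {g \<in> carrier (GL n). flag n g \<in> U})"
    unfolding istopology_def
  proof (intro conjI allI impI; (elim conjE)?)
    fix S T
    assume "openin (GL_topology n) {g \<in> carrier (GL n). flag n g \<in> S}"
      and "openin (GL_topology n) {g \<in> carrier (GL n). flag n g \<in> T}"
    moreover have "{g \<in> carrier (GL n). flag n g \<in> S \<inter> T} =
      {g \<in> carrier (GL n). flag n g \<in> S} \<inter> {g \<in> carrier (GL n). flag n g \<in> T}"
      by auto
    ultimately show "openin (GL_topology n) {g \<in> carrier (GL n). flag n g \<in> S \<inter> T}"
      by (simp only: openin_Int)
  next
    fix \<K>
    assume "\<forall>K\<in>\<K>. K \<subseteq> Fl n \<and> openin (GL_topology n) {g \<in> carrier (GL n). flag n g \<in> K}"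
    then have "openin (GL_topology n) (\<Union>K\<in>\<K>. {g \<in> carrier (GL n). flag n g \<in> K})"
      by (intro openin_Union) auto
    moreover have "{g \<in> carrier (GL n). flag n g \<in> \<Union>\<K>} =
      (\<Union>K\<in>\<K>. {g \<in> carrier (GL n). flag n g \<in> K})"
      by auto
    ultimately show "openin (GL_topology n) {g \<in> carrier (GL n). flag n g \<in> \<Union>\<K>}"
      by (simp only:)
  qed auto
  then show ?thesis
    by (simp add: Fl_topology_def topology_inverse')
qed

lemma topspace_Fl_topology: "topspace (Fl_topology n) = Fl n"
proof (rule subset_antisym)
  show "topspace (Fl_topology n) \<subseteq> Fl n"
    using openin_Fl_topology openin_topspace by blast
  have "{g \<in> carrier (GL n). flag n g \<in> Fl n} = topspace (GL_topology n)"
    by (auto simp: topspace_GL_topology Fl_def)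
  then have "openin (Fl_topology n) (Fl n)"
    by (simp add: openin_Fl_topology)
  then show "Fl n \<subseteq> topspace (Fl_topology n)"
    by (rule openin_subset)
qed

lemma quotient_map_flag: "quotient_map (GL_topology n) (Fl_topology n) (flag n)"
  by (auto simp: quotient_map_def openin_Fl_topology topspace_Fl_topology
      topspace_GL_topology Fl_def)


subsection \<open>Total positivity\<close>

definition minor :: "'a::comm_ring_1 mat \<Rightarrow> nat set \<Rightarrow> nat set \<Rightarrow> 'a" where
  "minor A I J = Determinant.det (submatrix A I J)"

definition GL_pos :: "nat \<Rightarrow> real mat set" where
  "GL_pos n = {g \<in> carrier_mat n n.
     \<forall>I \<subseteq> {..<n}. \<forall>J \<subseteq> {..<n}. card I = card J \<longrightarrow> minor g I J > 0}"

definition Fl_pos :: "nat \<Rightarrow> complex mat set set" where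
  "Fl_pos n = real_flag n ` GL_pos n"

definition Fl_nonneg :: "nat \<Rightarrow> complex mat set set" where
  "Fl_nonneg n = Fl_topology n closure_of Fl_pos n"


subsection \<open>The twist map\<close>

text \<open>Note that \<^const>\<open>orthogonal_mat\<close> does not require the columns to be normalised.\<close>

definition orthogonal_rep :: "nat \<Rightarrow> complex mat set \<Rightarrow> real mat \<Rightarrow> bool" where
  "orthogonal_rep n V g \<longleftrightarrow>
     g \<in> carrier_mat n n \<and> transpose_mat g * g = 1\<^sub>m n \<and>
     (\<forall>I \<subseteq> {..<n}. minor g I {..<card I} \<ge> 0) \<and>
     real_flag n g = V"

definition delta :: "nat \<Rightarrow> real mat" where
  "delta n = mat_diag n (\<lambda>i. (- 1) ^ i)"

definition twist :: "nat \<Rightarrow> complex mat set \<Rightarrow> complex mat set" where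
  "twist n V =
     (let g = (THE g. orthogonal_rep n V g)
      in real_flag n (delta n * inv\<^bsub>ring_mat TYPE(real) n ()\<^esub> g * delta n))"

end

theory Submission
  imports "HOL-Analysis.Abstract_Topological_Spaces" Defs
begin

text \<open>Let \<open>Q\<close> run through the real orthogonal matrices all of whose left-justified minors are positive.
  Their flags are exactly those in \<open>Fl_pos\<close>. In one direction this is the QR decomposition. In the
  other, write \<open>Q = L U\<close>; a lower triangular \<open>L\<close> whose left-justified minors are positive has all its
  minors \<open>(r, c)\<close> with \<open>c \<le> r\<close> positive (a Fekete-type criterion, from the three-term Pluecker
  relation) and all the others zero, so that \<open>L L\<^sup>T\<close> is totally positive by Cauchy--Binet and has the
  same flag as \<open>Q\<close>.

  The twist preserves this set of matrices: since \<open>Q\<close> is orthogonal, \<open>P = (U\<^sup>T)\<^sup>-\<^sup>1\<close> satisfies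
  \<open>L\<^sup>T L = P U\<^sup>-\<^sup>1\<close>, so \<open>P\<close> is lower triangular with positive left-justified minors. By Jacobi's
  identity the left-justified minors of \<open>\<delta> U\<^sup>T \<delta> = \<delta> P\<^sup>-\<^sup>1 \<delta>\<close> are quotients of positive minors of \<open>P\<close>,
  and those of \<open>\<delta> Q\<^sup>T \<delta> = (\<delta> U\<^sup>T \<delta>) (\<delta> L\<^sup>T \<delta>)\<close> differ from them by positive factors.

  Finally, the closure of this set of matrices is compact, so its image in the flag variety is closed
  and hence equal to \<open>Fl_nonneg\<close>; the continuous map \<open>Q \<mapsto> \<delta> Q\<^sup>T \<delta>\<close> preserves the closure.\<close>

subsection \<open>Minors and the Cauchy--Binet formula\<close>

text \<open>A \<open>k\<close>-element index set is handled through its increasing enumeration, so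
  that single indices can be compared and moved; values of \<open>r\<close> at arguments from
  \<open>k\<close> on are irrelevant.\<close>

definition increasing :: "nat \<Rightarrow> nat \<Rightarrow> (nat \<Rightarrow> nat) \<Rightarrow> bool" where
  "increasing k n r \<longleftrightarrow> strict_mono_on {..<k} r \<and> r ` {..<k} \<subseteq> {..<n}"

text \<open>The index functions may repeat values or be unordered; the expansions and column
  substitutions below rely on this.\<close>

definition sub_det :: "'a::comm_ring_1 mat \<Rightarrow> nat \<Rightarrow> (nat \<Rightarrow> nat) \<Rightarrow> (nat \<Rightarrow> nat) \<Rightarrow> 'a" where
  "sub_det A k r c = det (mat k k (\<lambda>(i, j). A $$ (r i, c j)))"

lemma increasing_less: "increasing k n r \<Longrightarrow> i < k \<Longrightarrow> r i < n"
  by (auto simp: increasing_def)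

lemma increasing_mono: "increasing k n r \<Longrightarrow> i < j \<Longrightarrow> j < k \<Longrightarrow> r i < r j"
  by (auto simp: increasing_def strict_mono_on_def)

lemma increasing_inj: "increasing k n r \<Longrightarrow> inj_on r {..<k}"
  by (auto simp: increasing_def strict_mono_on_imp_inj_on)

lemma increasingI:
  "(\<And>i j. i < j \<Longrightarrow> j < k \<Longrightarrow> r i < r j) \<Longrightarrow> (\<And>i. i < k \<Longrightarrow> r i < n) \<Longrightarrow> increasing k n r"
  by (auto simp: increasing_def strict_mono_on_def)

lemma increasing_ge: "increasing k n r \<Longrightarrow> i < k \<Longrightarrow> i \<le> r i"
proof (induction i)
  case (Suc i)
  then have "i \<le> r i" by simp
  also have "r i < r (Suc i)" using increasing_mono[OF Suc.prems(1)] Suc.prems(2) by auto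
  finally show ?case by simp
qed simp

lemma increasing_ge_add: "increasing k n r \<Longrightarrow> i + j < k \<Longrightarrow> r i + j \<le> r (i + j)"
proof (induction j)
  case (Suc j)
  then have "r i + j \<le> r (i + j)" by simp
  also have "r (i + j) < r (i + Suc j)" using increasing_mono[OF Suc.prems(1)] Suc.prems(2) by auto
  finally show ?case by simp
qed simp

lemma increasing_le: "increasing k n r \<Longrightarrow> k \<le> n"
  using card_inj_on_le[OF increasing_inj, of k n r "{..<n}"] by (simp add: increasing_def)

lemma increasing_id: "k \<le> n \<Longrightarrow> increasing k n id"
  by (auto intro!: increasingI)

text \<open>The \<open>k - 1 - i\<close> later values of \<open>r\<close> still have to fit between
  \<open>r i\<close> and \<open>n\<close>.\<close>

lemma increasing_le_top:
  assumes "increasing k n r" "i < k" shows "r i \<le> n - k + i"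
proof -
  have "r i + (k - 1 - i) \<le> r (i + (k - 1 - i))"
    using assms by (intro increasing_ge_add) auto
  moreover have "r (i + (k - 1 - i)) < n"
    using assms by (intro increasing_less[OF assms(1)]) auto
  ultimately show ?thesis using assms increasing_le[OF assms(1)] by linarith
qed

lemma increasing_pick:
  assumes "I \<subseteq> {..<n}" shows "increasing (card I) n (pick I)"
proof (rule increasingI)
  show "pick I i < pick I j" if "i < j" "j < card I" for i j
    using that by (intro pick_mono) auto
  show "pick I i < n" if "i < card I" for i
    using pick_in_set[of i I] that assms by auto
qed

lemma pick_image: "finite I \<Longrightarrow> pick I ` {..<card I} = I"
proof (rule card_subset_eq)
  assume fin: "finite I"
  then obtain n where I: "I \<subseteq> {..<n}" using finite_nat_iff_bounded by blast
  show "pick I ` {..<card I} \<subseteq> I" using pick_in_set by auto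
  show "card (pick I ` {..<card I}) = card I"
    using card_image[OF increasing_inj[OF increasing_pick[OF I]]] by simp
qed auto

lemma pick_image_increasing:
  assumes r: "increasing k n r" and "i < k" shows "pick (r ` {..<k}) i = r i"
proof -
  \<comment> \<open>Exactly the \<open>i\<close> earlier values lie below \<open>r i\<close>, so
    \<open>pick\<close> finds it at rank \<open>i\<close>.\<close>
  have "{a \<in> r ` {..<k}. a < r i} = r ` {..<i}"
  proof (intro Set.set_eqI iffI)
    fix a assume "a \<in> {a \<in> r ` {..<k}. a < r i}"
    then obtain j where "a = r j" "j < k" "r j < r i" by auto
    then show "a \<in> r ` {..<i}"
      using increasing_mono[OF r, of i j] by (cases "j < i") (auto simp: not_less le_less)
  qed (use \<open>i < k\<close> increasing_mono[OF r] in auto)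
  moreover have "inj_on r {..<i}"
    using increasing_inj[OF r] \<open>i < k\<close> by (auto intro: inj_on_subset)
  ultimately have "card {a \<in> r ` {..<k}. a < r i} = i"
    by (simp add: card_image)
  then show ?thesis
    using pick_card_in_set[of "r i" "r ` {..<k}"] \<open>i < k\<close> by auto
qed

lemma pick_lessThan: "i < k \<Longrightarrow> pick {..<k} i = i"
  using pick_image_increasing[OF increasing_id[of k k]] by simp

lemma sub_det_cong:
  assumes "\<And>i. i < k \<Longrightarrow> r i = r' i" "\<And>i. i < k \<Longrightarrow> c i = c' i"
  shows "sub_det A k r c = sub_det A k r' c'"
  unfolding sub_det_def using assms by (intro arg_cong[where f = det] eq_matI) auto

lemma minor_eq_sub_det:
  assumes A: "A \<in> carrier_mat n m" and I: "I \<subseteq> {..<n}" "J \<subseteq> {..<m}" and k: "card I = k" "card J = k"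
  shows "minor A I J = sub_det A k (pick I) (pick J)"
proof -
  have "{i. i < n \<and> i \<in> I} = I" "{j. j < m \<and> j \<in> J} = J" using I by auto
  then show ?thesis
    using A k by (simp add: minor_def sub_det_def submatrix_def)
qed

lemma sub_det_eq_minor:
  assumes A: "A \<in> carrier_mat n m" and "increasing k n r" "increasing k m c"
  shows "sub_det A k r c = minor A (r ` {..<k}) (c ` {..<k})"
proof -
  have "card (r ` {..<k}) = k" "card (c ` {..<k}) = k"
    using assms by (auto simp: card_image increasing_inj)
  moreover have "r ` {..<k} \<subseteq> {..<n}" "c ` {..<k} \<subseteq> {..<m}"
    using assms by (auto simp: increasing_def)
  ultimately have "minor A (r ` {..<k}) (c ` {..<k})
      = sub_det A k (pick (r ` {..<k})) (pick (c ` {..<k}))"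
    using A by (intro minor_eq_sub_det)
  also have "\<dots> = sub_det A k r c"
    using assms by (intro sub_det_cong) (auto simp: pick_image_increasing)
  finally show ?thesis by simp
qed

lemma sub_det_transpose:
  assumes A: "A \<in> carrier_mat n m" and "\<And>i. i < k \<Longrightarrow> r i < m" "\<And>i. i < k \<Longrightarrow> c i < n"
  shows "sub_det (transpose_mat A) k r c = sub_det A k c r"
proof -
  have "mat k k (\<lambda>(i, j). transpose_mat A $$ (r i, c j))
      = transpose_mat (mat k k (\<lambda>(i, j). A $$ (c i, r j)))"
    using assms by (intro eq_matI) auto
  then show ?thesis unfolding sub_det_def by (simp add: det_transpose[of _ k])
qed

lemma permutes_lt: "p permutes {0..<k} \<Longrightarrow> i < k \<Longrightarrow> p i < (k::nat)"
  using permutes_in_image[of p "{0..<k}" i] by simp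

lemma sub_det_permute_rows:
  assumes "p permutes {0..<k}"
  shows "sub_det A k (r \<circ> p) c = signof p * sub_det A k r c"
proof -
  have "mat k k (\<lambda>(i, j). A $$ ((r \<circ> p) i, c j))
      = mat k k (\<lambda>(i, j). mat k k (\<lambda>(i, j). A $$ (r i, c j)) $$ (p i, j))"
    using assms by (intro eq_matI) (auto simp: permutes_lt)
  then show ?thesis unfolding sub_det_def by (simp add: det_permute_rows[OF _ assms])
qed

lemma sub_det_equal_rows:
  assumes "i < k" "j < k" "i \<noteq> j" "r i = r j"
  shows "sub_det A k r c = 0"
proof -
  let ?M = "mat k k (\<lambda>(i, j). A $$ (r i, c j))"
  have "row ?M i = row ?M j" using assms by (intro eq_vecI) simp_all
  then show ?thesis unfolding sub_det_def using assms by (intro det_identical_rows[where n = k and i = i and j = j]) auto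
qed

text \<open>Expanding every entry of the product gives a sum over all maps \<open>f\<close> from
  rows to middle indices. Maps that are not injective contribute 0; the others are grouped by their
  image \<open>K\<close>, and within a group they are \<open>pick K\<close> composed with the
  permutations.\<close>

theorem Cauchy_Binet:
  fixes A B :: "'a::comm_ring_1 mat"
  assumes A: "A \<in> carrier_mat n m" and B: "B \<in> carrier_mat m l"
    and r: "\<And>i. i < k \<Longrightarrow> r i < n" and c: "\<And>i. i < k \<Longrightarrow> c i < l"
  shows "sub_det (A * B) k r c =
    (\<Sum>K | K \<subseteq> {..<m} \<and> card K = k. sub_det A k r (pick K) * sub_det B k (pick K) c)"
proof -
  let ?F = "{0..<k} \<rightarrow>\<^sub>E {..<m}"
  let ?P = "{p. p permutes {0..<k}}"
  let ?KK = "{K. K \<subseteq> {..<m} \<and> card K = k}"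
  let ?g = "\<lambda>f. (\<Prod>i = 0..<k. A $$ (r i, f i)) * sub_det B k f c"
  have entry: "(A * B) $$ (r i, c j) = (\<Sum>x<m. A $$ (r i, x) * B $$ (x, c j))"
    if "i < k" "j < k" for i j
    using A B r[OF that(1)] c[OF that(2)] by (auto simp: scalar_prod_def lessThan_atLeast0)
  have "sub_det (A * B) k r c
      = (\<Sum>p\<in>?P. signof p * (\<Prod>i = 0..<k. (A * B) $$ (r i, c (p i))))"
    unfolding sub_det_def by (subst det_def'[of _ k]) (auto intro!: sum.cong prod.cong simp: permutes_lt)
  also have "\<dots> = (\<Sum>p\<in>?P. signof p * (\<Prod>i = 0..<k. \<Sum>x<m. A $$ (r i, x) * B $$ (x, c (p i))))"
    using entry by (intro sum.cong refl arg_cong2[where f = "(*)"] prod.cong) (auto simp: permutes_lt)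
  also have "\<dots> = (\<Sum>p\<in>?P. \<Sum>f\<in>?F. signof p * (\<Prod>i = 0..<k. A $$ (r i, f i) * B $$ (f i, c (p i))))"
    by (simp add: prod_sum_PiE sum_distrib_left)
  also have "\<dots> = (\<Sum>f\<in>?F. \<Sum>p\<in>?P. signof p * (\<Prod>i = 0..<k. A $$ (r i, f i) * B $$ (f i, c (p i))))"
    by (rule sum.swap)
  \<comment> \<open>For fixed \<open>f\<close> the sum over \<open>p\<close> is the Leibniz
    expansion of the minor of \<open>B\<close> with rows \<open>f\<close>.\<close>
  also have "\<dots> = (\<Sum>f\<in>?F. ?g f)"
  proof (rule sum.cong[OF refl])
    fix f
    have "sub_det B k f c = (\<Sum>p\<in>?P. signof p * (\<Prod>i = 0..<k. B $$ (f i, c (p i))))"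
      unfolding sub_det_def by (subst det_def'[of _ k]) (auto intro!: sum.cong prod.cong simp: permutes_lt)
    then show "(\<Sum>p\<in>?P. signof p * (\<Prod>i = 0..<k. A $$ (r i, f i) * B $$ (f i, c (p i)))) = ?g f"
      by (simp add: prod.distrib sum_distrib_left mult_ac)
  qed
  also have "\<dots> = (\<Sum>f\<in>{f \<in> ?F. inj_on f {0..<k}}. ?g f)"
  proof (rule sum.mono_neutral_right)
    show "finite ?F" by (intro finite_PiE) auto
    show "\<forall>f\<in>?F - {f \<in> ?F. inj_on f {0..<k}}. ?g f = 0"
    proof
      fix f assume "f \<in> ?F - {f \<in> ?F. inj_on f {0..<k}}"
      then obtain i j where "i < k" "j < k" "i \<noteq> j" "f i = f j" by (auto simp: inj_on_def)
      then show "?g f = 0" by (simp add: sub_det_equal_rows[of i k j])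
    qed
  qed auto
  also have "\<dots> = (\<Sum>K\<in>?KK. \<Sum>f\<in>{f \<in> {f \<in> ?F. inj_on f {0..<k}}. f ` {0..<k} = K}. ?g f)"
  proof (rule sum.group[symmetric])
    show "finite {f \<in> ?F. inj_on f {0..<k}}"
      by (rule finite_subset[of _ ?F]) (auto intro: finite_PiE)
  qed (auto simp: card_image PiE_iff)
  also have "\<dots> = (\<Sum>K\<in>?KK. sub_det A k r (pick K) * sub_det B k (pick K) c)"
  proof (rule sum.cong[OF refl])
    fix K assume K: "K \<in> ?KK"
    have fK: "finite K" using K finite_subset by blast
    have incr: "increasing k m (pick K)" using K increasing_pick[of K m] by auto
    have img: "pick K ` {0..<k} = K" using pick_image[OF fK] K by (simp add: lessThan_atLeast0)
    \<comment> \<open>The \<open>restrict\<close> reconciles two conventions: members of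
      \<open>?F\<close> are \<open>undefined\<close> outside \<open>{0..<k}\<close>, whereas a
      permutation is the identity there.\<close>
    have bij: "bij_betw (\<lambda>p. restrict (pick K \<circ> p) {0..<k}) ?P
        {f \<in> {f \<in> ?F. inj_on f {0..<k}}. f ` {0..<k} = K}"
    proof (rule bij_betw_byWitness[where f' = "\<lambda>f i. if i < k then inv_into {0..<k} (pick K) (f i) else i"])
      have inj: "inj_on (pick K) {0..<k}" using increasing_inj[OF incr] by (simp add: lessThan_atLeast0)
      then have bK: "bij_betw (pick K) {0..<k} K" using img by (simp add: bij_betw_def)
      show "\<forall>p\<in>?P. (\<lambda>i. if i < k then inv_into {0..<k} (pick K) (restrict (pick K \<circ> p) {0..<k} i) else i) = p"
        using inj by (auto simp: fun_eq_iff permutes_lt inv_into_f_f) (auto simp: permutes_def)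
      show "\<forall>f\<in>{f \<in> {f \<in> ?F. inj_on f {0..<k}}. f ` {0..<k} = K}.
          restrict (pick K \<circ> (\<lambda>i. if i < k then inv_into {0..<k} (pick K) (f i) else i)) {0..<k} = f"
      proof
        fix f assume f: "f \<in> {f \<in> {f \<in> ?F. inj_on f {0..<k}}. f ` {0..<k} = K}"
        show "restrict (pick K \<circ> (\<lambda>i. if i < k then inv_into {0..<k} (pick K) (f i) else i)) {0..<k} = f"
        proof
          fix i
          show "restrict (pick K \<circ> (\<lambda>i. if i < k then inv_into {0..<k} (pick K) (f i) else i)) {0..<k} i = f i"
            using f img by (cases "i < k") (auto intro!: f_inv_into_f simp: PiE_iff extensional_def)
        qed
      qed
      show "(\<lambda>p. restrict (pick K \<circ> p) {0..<k}) ` ?P \<subseteq> {f \<in> {f \<in> ?F. inj_on f {0..<k}}. f ` {0..<k} = K}"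
      proof (rule image_subsetI)
        fix p assume "p \<in> ?P"
        then have p: "p permutes {0..<k}" by simp
        have bp: "bij_betw (restrict (pick K \<circ> p) {0..<k}) {0..<k} K"
          using bij_betw_trans[OF permutes_imp_bij[OF p] bK] by (subst bij_betw_restrict_eq) auto
        then have "restrict (pick K \<circ> p) {0..<k} \<in> ?F"
          using K by (intro PiE_I) (auto simp: bij_betw_def)
        with bp show "restrict (pick K \<circ> p) {0..<k} \<in> {f \<in> {f \<in> ?F. inj_on f {0..<k}}. f ` {0..<k} = K}"
          unfolding bij_betw_def by blast
      qed
      show "(\<lambda>f i. if i < k then inv_into {0..<k} (pick K) (f i) else i) `
          {f \<in> {f \<in> ?F. inj_on f {0..<k}}. f ` {0..<k} = K} \<subseteq> ?P"
      proof safe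
        fix f assume f: "f \<in> ?F" "inj_on f {0..<k}" "K = f ` {0..<k}"
        have "bij_betw f {0..<k} K" using f by (simp add: bij_betw_def)
        then have "bij_betw (inv_into {0..<k} (pick K) \<circ> f) {0..<k} {0..<k}"
          using bij_betw_inv_into[OF bK] by (rule bij_betw_trans)
        then have "bij_betw (\<lambda>i. if i < k then inv_into {0..<k} (pick K) (f i) else i) {0..<k} {0..<k}"
          by (subst bij_betw_cong[where g = "inv_into {0..<k} (pick K) \<circ> f"]) auto
        then show "(\<lambda>i. if i < k then inv_into {0..<k} (pick (f ` {0..<k})) (f i) else i) permutes {0..<k}"
          unfolding f(3) by (rule bij_imp_permutes) auto
      qed
    qed
    have "(\<Sum>f\<in>{f \<in> {f \<in> ?F. inj_on f {0..<k}}. f ` {0..<k} = K}. ?g f)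
        = (\<Sum>p\<in>?P. ?g (restrict (pick K \<circ> p) {0..<k}))"
      by (rule sum.reindex_bij_betw[OF bij, symmetric])
    also have "\<dots> = (\<Sum>p\<in>?P. (\<Prod>i = 0..<k. A $$ (r i, pick K (p i))) * (signof p * sub_det B k (pick K) c))"
    proof (rule sum.cong[OF refl])
      fix p assume "p \<in> ?P"
      then have p: "p permutes {0..<k}" by simp
      have "sub_det B k (restrict (pick K \<circ> p) {0..<k}) c = sub_det B k (pick K \<circ> p) c"
        by (rule sub_det_cong) auto
      then show "?g (restrict (pick K \<circ> p) {0..<k})
          = (\<Prod>i = 0..<k. A $$ (r i, pick K (p i))) * (signof p * sub_det B k (pick K) c)"
        by (simp add: sub_det_permute_rows[OF p])
    qed
    \<comment> \<open>The signs from reordering the rows of \<open>B\<close> complete the Leibniz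
      expansion for \<open>A\<close>.\<close>
    also have "\<dots> = sub_det A k r (pick K) * sub_det B k (pick K) c"
      unfolding sub_det_def[of A] det_def'[of "mat k k _" k, OF mat_carrier] sum_distrib_right
      by (intro sum.cong refl) (auto simp: permutes_lt mult_ac intro!: prod.cong)
    finally show "(\<Sum>f\<in>{f \<in> {f \<in> ?F. inj_on f {0..<k}}. f ` {0..<k} = K}. ?g f)
        = sub_det A k r (pick K) * sub_det B k (pick K) c" .
  qed
  finally show ?thesis .
qed

subsection \<open>Lower triangular matrices with positive left-justified minors\<close>

lemma sub_det_equal_cols:
  assumes "i < k" "j < k" "i \<noteq> j" "c i = c j"
  shows "sub_det A k r c = 0"
proof -
  let ?M = "mat k k (\<lambda>(i, j). A $$ (r i, c j))"
  have "col ?M i = col ?M j" using assms by (intro eq_vecI) simp_all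
  then show ?thesis
    unfolding sub_det_def using assms by (intro det_identical_columns[where n = k and i = i and j = j]) auto
qed

text \<open>Put row \<open>r i\<close> on top of the rows \<open>r 0\<close>, ...,
  \<open>r (k - 1)\<close>, with columns \<open>d 0\<close>, ..., \<open>d k\<close>: two rows
  agree, and Laplace expansion along the top row gives the relation.\<close>

lemma sub_det_row_relation:
  assumes "i < k"
  shows "(\<Sum>j<Suc k. (-1) ^ j * A $$ (r i, d j) * sub_det A k r (d \<circ> insert_index j)) = 0"
proof -
  define Z where "Z = mat (Suc k) (Suc k) (\<lambda>(a, b). A $$ (r (case a of 0 \<Rightarrow> i | Suc a' \<Rightarrow> a'), d b))"
  have Z: "Z \<in> carrier_mat (Suc k) (Suc k)" by (simp add: Z_def)
  have "row Z 0 = row Z (Suc i)" using assms by (intro eq_vecI) (simp_all add: Z_def)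
  then have "0 = det Z"
    using assms Z by (intro det_identical_rows[where n = "Suc k" and i = 0 and j = "Suc i", symmetric]) auto
  also have "\<dots> = (\<Sum>j<Suc k. Z $$ (0, j) * cofactor Z 0 j)"
    by (rule laplace_expansion_row[OF Z]) simp
  also have "\<dots> = (\<Sum>j<Suc k. (-1) ^ j * A $$ (r i, d j) * sub_det A k r (d \<circ> insert_index j))"
  proof (rule sum.cong[OF refl])
    fix j assume j: "j \<in> {..<Suc k}"
    have "mat_delete Z 0 j = mat k k (\<lambda>(a, b). A $$ (r a, (d \<circ> insert_index j) b))"
      by (intro eq_matI) (auto simp: mat_delete_def Z_def insert_index_def)
    then show "Z $$ (0, j) * cofactor Z 0 j = (-1) ^ j * A $$ (r i, d j) * sub_det A k r (d \<circ> insert_index j)"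
      using j by (simp add: cofactor_def sub_det_def Z_def)
  qed
  finally show ?thesis by simp
qed

text \<open>In the Laplace expansion along column \<open>t\<close> the cofactors do not see that
  column, so the minor is a linear form in it.\<close>

lemma sub_det_col_functional:
  assumes "t < q"
  obtains C where "\<And>x. sub_det A q r (e(t := x)) = (\<Sum>i<q. A $$ (r i, x) * C i)"
proof
  fix x
  let ?M = "mat q q (\<lambda>(i, j). A $$ (r i, (e(t := x)) j))"
  let ?N = "mat q q (\<lambda>(i, j). A $$ (r i, e j))"
  have "mat_delete ?M i t = mat_delete ?N i t" for i
    by (intro eq_matI) (use assms in \<open>auto simp: mat_delete_def\<close>)
  then show "sub_det A q r (e(t := x)) = (\<Sum>i<q. A $$ (r i, x) * cofactor ?N i t)"
    unfolding sub_det_def using assms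
    by (subst laplace_expansion_column[of ?M q t]) (auto simp: cofactor_def intro!: sum.cong)
qed

text \<open>The two column orders differ by a cycle, that is by \<open>t\<close> adjacent swaps; the
  induction adds one swap at a time.\<close>

lemma sub_det_col_to_front:
  assumes "t < q"
  shows "sub_det A q r (\<lambda>b. if b = t then c 0 else if b < t then c (Suc b) else c b) = (-1) ^ t * sub_det A q r c"
  using assms
proof (induction t)
  case 0
  have "sub_det A q r (\<lambda>b. if b = 0 then c 0 else if b < 0 then c (Suc b) else c b) = sub_det A q r c"
    by (rule sub_det_cong) auto
  then show ?case by simp
next
  case (Suc t)
  let ?c = "\<lambda>t b. if b = t then c 0 else if b < t then c (Suc b) else c b"
  let ?M = "\<lambda>t. mat q q (\<lambda>(i, j). A $$ (r i, ?c t j))"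
  have "?M (Suc t) = swapcols t (Suc t) (?M t)"
    using Suc.prems by (intro eq_matI) auto
  then have "det (?M (Suc t)) = - det (?M t)"
    using Suc.prems by (simp add: det_swapcols[where n = q])
  then show ?case
    using Suc by (simp add: sub_det_def)
qed

text \<open>Obtained by pairing the relation above with a \<open>q\<close>-minor, as a function of one of its columns,
  that vanishes at all columns \<open>d j\<close> except \<open>d 0\<close>, \<open>d m\<close> and \<open>d (m + 1)\<close>.\<close>

lemma sub_det_three_term:
  fixes A :: "'a::comm_ring_1 mat"
  assumes k: "k = Suc q" and m: "0 < m" "m < k"
  shows "sub_det A q (r \<circ> Suc) (\<lambda>b. d (Suc (insert_index m b))) * sub_det A k r (d \<circ> insert_index m)
    = sub_det A q (r \<circ> Suc) (\<lambda>b. if b < m then d b else d (Suc (Suc b))) * sub_det A k r (d \<circ> Suc)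
    + sub_det A q (r \<circ> Suc) (\<lambda>b. d (Suc (insert_index (m - 1) b))) * sub_det A k r (d \<circ> insert_index (Suc m))"
proof -
  \<comment> \<open>\<open>e\<close> lists \<open>d 1\<close>, ..., \<open>d k\<close> without
    \<open>d (Suc m)\<close>. Position \<open>t\<close> holds \<open>d m\<close> and is the one
    replaced by \<open>x\<close>, so \<open>f\<close> vanishes at every other listed column.\<close>
  define e where "e b = d (Suc (insert_index m b))" for b
  define t where "t = m - 1"
  define f where "f x = sub_det A q (r \<circ> Suc) (e(t := x))" for x
  define \<Delta> where "\<Delta> j = sub_det A k r (d \<circ> insert_index j)" for j
  have t: "t < q" "m = Suc t" using k m by (auto simp: t_def)
  obtain C where C: "f x = (\<Sum>i<q. A $$ (r (Suc i), x) * C i)" for x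
    using sub_det_col_functional[OF t(1), of A "r \<circ> Suc" e] by (auto simp: f_def)
  \<comment> \<open>Linearity of \<open>f\<close> combines the row relations, one for each row
    \<open>r (Suc i)\<close>, into a single relation with coefficients
    \<open>f (d j)\<close>.\<close>
  have "(\<Sum>j<Suc k. (-1) ^ j * f (d j) * \<Delta> j)
      = (\<Sum>j<Suc k. \<Sum>i<q. C i * ((-1) ^ j * A $$ (r (Suc i), d j) * \<Delta> j))"
    by (simp add: C sum_distrib_left sum_distrib_right mult_ac)
  also have "\<dots> = (\<Sum>i<q. C i * (\<Sum>j<Suc k. (-1) ^ j * A $$ (r (Suc i), d j) * \<Delta> j))"
    by (subst sum.swap) (simp add: sum_distrib_left del: sum.lessThan_Suc)
  also have "\<dots> = 0"
    using sub_det_row_relation[of "Suc _" k A r d] k by (simp add: \<Delta>_def del: sum.lessThan_Suc)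
  finally have rel: "(\<Sum>j<Suc k. (-1) ^ j * f (d j) * \<Delta> j) = 0" .
  have zero: "f (d j) = 0" if j: "j < Suc k" "j \<notin> {0, m, Suc m}" for j
  proof -
    define b where "b = (if j < m then j - 1 else j - 2)"
    have b: "b < q" "b \<noteq> t" "e b = d j"
      using j t k by (auto simp: b_def e_def insert_index_def Suc_diff_Suc numeral_2_eq_2)
    then show ?thesis
      unfolding f_def using t(1) by (intro sub_det_equal_cols[of b q t]) auto
  qed
  have "(\<Sum>j<Suc k. (-1) ^ j * f (d j) * \<Delta> j) = (\<Sum>j\<in>{0, m, Suc m}. (-1) ^ j * f (d j) * \<Delta> j)"
    by (rule sum.mono_neutral_right) (use m zero in auto)
  then have rel2: "f (d 0) * \<Delta> 0 + (-1) ^ m * f (d m) * \<Delta> m - (-1) ^ m * f (d (Suc m)) * \<Delta> (Suc m) = 0"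
    using rel m by (simp add: algebra_simps del: sum.lessThan_Suc)
  let ?g = "\<lambda>b. if b < m then d b else d (Suc (Suc b))"
  have "f (d 0) = sub_det A q (r \<circ> Suc) (\<lambda>b. if b = t then ?g 0 else if b < t then ?g (Suc b) else ?g b)"
    unfolding f_def by (rule sub_det_cong) (auto simp: e_def t insert_index_def)
  also have "\<dots> = (-1) ^ t * sub_det A q (r \<circ> Suc) ?g"
    by (rule sub_det_col_to_front[OF t(1)])
  finally have f0: "f (d 0) = (-1) ^ t * sub_det A q (r \<circ> Suc) ?g" .
  have fm: "f (d m) = sub_det A q (r \<circ> Suc) (\<lambda>b. d (Suc (insert_index m b)))"
    unfolding f_def by (rule sub_det_cong) (auto simp: e_def t insert_index_def)
  have fm1: "f (d (Suc m)) = sub_det A q (r \<circ> Suc) (\<lambda>b. d (Suc (insert_index (m - 1) b)))"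
    unfolding f_def by (rule sub_det_cong) (auto simp: e_def t insert_index_def)
  have "\<Delta> 0 = sub_det A k r (d \<circ> Suc)"
    unfolding \<Delta>_def by (rule sub_det_cong) (auto simp: insert_index_def)
  moreover have "f (d m) * \<Delta> m = sub_det A q (r \<circ> Suc) ?g * \<Delta> 0 + f (d (Suc m)) * \<Delta> (Suc m)"
  proof -
    \<comment> \<open>The common sign is removed by multiplying with it once more, since its square
      is 1.\<close>
    have "(-1) ^ t * (sub_det A q (r \<circ> Suc) ?g * \<Delta> 0 - f (d m) * \<Delta> m + f (d (Suc m)) * \<Delta> (Suc m)) = 0"
      using rel2 unfolding f0 t(2) by (simp add: algebra_simps)
    then have "(-1) ^ t * ((-1) ^ t * (sub_det A q (r \<circ> Suc) ?g * \<Delta> 0 - f (d m) * \<Delta> m + f (d (Suc m)) * \<Delta> (Suc m))) = 0"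
      by simp
    then have "sub_det A q (r \<circ> Suc) ?g * \<Delta> 0 - f (d m) * \<Delta> m + f (d (Suc m)) * \<Delta> (Suc m) = 0"
      by (simp only: mult.assoc[symmetric] power_add[symmetric]) (simp add: mult_2[symmetric] power_mult)
    then show ?thesis by (simp add: algebra_simps)
  qed
  ultimately show ?thesis
    unfolding fm fm1 by (simp add: \<Delta>_def)
qed

section \<open>Signs of the minors of a lower triangular matrix\<close>

lemma sub_det_block:
  fixes A :: "'a::idom mat"
  assumes "\<And>i j. i < k \<Longrightarrow> k \<le> j \<Longrightarrow> j < k + l \<Longrightarrow> A $$ (r i, c j) = 0"
  shows "sub_det A (k + l) r c = sub_det A k r c * sub_det A l (\<lambda>i. r (k + i)) (\<lambda>j. c (k + j))"
proof -
  let ?A1 = "mat k k (\<lambda>(i, j). A $$ (r i, c j))"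
  let ?A3 = "mat l k (\<lambda>(i, j). A $$ (r (k + i), c j))"
  let ?A4 = "mat l l (\<lambda>(i, j). A $$ (r (k + i), c (k + j)))"
  have "mat (k + l) (k + l) (\<lambda>(i, j). A $$ (r i, c j)) = four_block_mat ?A1 (0\<^sub>m k l) ?A3 ?A4"
    using assms by (intro eq_matI) auto
  then show ?thesis
    unfolding sub_det_def by (simp add: det_four_block_mat_upper_right_zero[of _ k _ l])
qed

definition lower_tri :: "nat \<Rightarrow> 'a::zero mat \<Rightarrow> bool" where
  "lower_tri n A \<longleftrightarrow> A \<in> carrier_mat n n \<and> (\<forall>i<n. \<forall>j<n. i < j \<longrightarrow> A $$ (i, j) = 0)"

text \<open>The strict form of the minor condition in \<open>orthogonal_rep\<close>;
  \<open>id\<close> enumerates the first \<open>k\<close> columns.\<close>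

definition left_pos :: "nat \<Rightarrow> real mat \<Rightarrow> bool" where
  "left_pos n A \<longleftrightarrow> (\<forall>k r. increasing k n r \<longrightarrow> sub_det A k r id > 0)"

text \<open>Rows up to position \<open>s\<close> and columns from position \<open>s\<close> on form
  a zero block, too large for any permutation to avoid.\<close>

lemma sub_det_lower_tri_zero:
  assumes A: "lower_tri n A" and r: "increasing k n r" and c: "increasing k n c"
    and s: "s < k" "r s < c s"
  shows "sub_det A k r c = 0"
proof -
  have zero: "A $$ (r a, c b) = 0" if "a \<le> s" "s \<le> b" "b < k" for a b
  proof -
    have "r a \<le> r s" using that s increasing_mono[OF r, of a s] by (cases "a = s") auto
    moreover have "c s \<le> c b" using that increasing_mono[OF c, of s b] by (cases "s = b") auto
    moreover have "r a < n" "c b < n" using that s increasing_less[OF r] increasing_less[OF c] by auto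
    ultimately show ?thesis using A s by (auto simp: lower_tri_def)
  qed
  have "(\<Prod>i = 0..<k. A $$ (r i, c (p i))) = 0" if p: "p permutes {0..<k}" for p
  proof -
    \<comment> \<open>Otherwise \<open>p\<close> would map the \<open>s + 1\<close> positions up to
      \<open>s\<close> injectively below \<open>s\<close>.\<close>
    have "\<exists>a\<le>s. s \<le> p a"
    proof (rule ccontr)
      assume "\<not> ?thesis"
      then have "p a < s" if "a \<le> s" for a using that by (meson not_le)
      then have "p ` {..s} \<subseteq> {..<s}" by auto
      moreover have "inj_on p {..s}" using permutes_inj[OF p] by (rule inj_on_subset) simp
      ultimately have "card {..s} \<le> card {..<s}" by (intro card_inj_on_le) auto
      then show False by simp
    qed
    then obtain a where a: "a \<le> s" "s \<le> p a" by blast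
    then have "A $$ (r a, c (p a)) = 0" using s permutes_lt[OF p] by (intro zero) auto
    then show ?thesis using a s by (intro prod_zero) auto
  qed
  then show ?thesis
    unfolding sub_det_def by (subst det_def'[of _ k]) (auto intro!: sum.neutral simp: permutes_lt)
qed

text \<open>Adding the first \<open>m\<close> rows and columns gives a left-justified minor.
  Triangularity makes it block triangular, so it is a leading minor times the minor in question, and
  the first two of these three are positive by \<open>left_pos\<close>.\<close>

lemma left_pos_lower_tri_contiguous:
  assumes A: "lower_tri n A" and pos: "left_pos n A"
    and r: "increasing k n r" and c: "\<And>b. b < k \<Longrightarrow> c b = m + b" "m + k \<le> n"
    and le: "\<And>a. a < k \<Longrightarrow> c a \<le> r a"
  shows "sub_det A k r c > 0"
proof -
  define r' where "r' a = (if a < m then a else r (a - m))" for a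
  have ge: "m + a \<le> r a" if "a < k" for a using le[OF that] c(1)[OF that] by simp
  \<comment> \<open>Since \<open>m + a \<le> r a\<close>, the added rows come before all rows of
    \<open>r\<close>.\<close>
  have incr: "increasing (m + k) n r'"
  proof (rule increasingI)
    fix i j assume ij: "i < j" "j < m + k"
    have "j \<le> r (j - m)" if "m \<le> j" using ge[of "j - m"] ij that by simp
    then show "r' i < r' j"
      using ij increasing_mono[OF r, of "i - m" "j - m"]
      by (cases "m \<le> j"; cases "m \<le> i") (auto simp: r'_def not_le)
  next
    fix i assume "i < m + k"
    then show "r' i < n" using c(2) increasing_less[OF r, of "i - m"] by (auto simp: r'_def)
  qed
  have "sub_det A (m + k) r' id = sub_det A m r' id * sub_det A k (\<lambda>i. r' (m + i)) (\<lambda>j. id (m + j))"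
    using A c(2) by (intro sub_det_block) (auto simp: lower_tri_def r'_def)
  also have "sub_det A m r' id = sub_det A m id id"
    by (rule sub_det_cong) (auto simp: r'_def)
  also have "sub_det A k (\<lambda>i. r' (m + i)) (\<lambda>j. id (m + j)) = sub_det A k r c"
    by (rule sub_det_cong) (auto simp: r'_def c(1))
  finally have "sub_det A (m + k) r' id = sub_det A m id id * sub_det A k r c" .
  moreover have "sub_det A (m + k) r' id > 0" using pos incr by (auto simp: left_pos_def)
  moreover have "sub_det A m id id > 0"
    using pos c(2) increasing_id[of m n] by (auto simp: left_pos_def)
  ultimately show ?thesis by (simp add: zero_less_mult_iff)
qed

text \<open>Outer induction on the size, inner induction on the columns. Consecutive columns are the
  base case; otherwise a column is inserted into a gap, and the three-term relation expresses the
  minor, times a positive smaller one, by minors whose signs are known already.\<close>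

theorem left_pos_lower_tri_sub_det_pos:
  assumes A: "lower_tri n A" and pos: "left_pos n A"
    and "increasing k n r" "increasing k n c" "\<And>a. a < k \<Longrightarrow> c a \<le> r a"
  shows "sub_det A k r c > 0"
  using assms(3-)
proof (induction k arbitrary: r c)
  case 0
  then show ?case by (simp add: sub_det_def)
next
  case (Suc q)
  define k where "k = Suc q"
  \<comment> \<open>Smaller in this order means a larger first column, or the same first column and
    a smaller column sum.\<close>
  let ?R = "inv_image (less_than <*lex*> less_than) (\<lambda>c. (n - c 0, \<Sum>b<k. c b))"
  have wf: "wf ?R" by (intro wf_inv_image wf_lex_prod wf_less_than)
  have r: "increasing k n r" using Suc.prems by (simp add: k_def)
  have r': "increasing q n (r \<circ> Suc)"
    using increasing_mono[OF r] increasing_less[OF r] by (auto intro!: increasingI simp: k_def)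
  have "increasing k n c \<longrightarrow> (\<forall>a<k. c a \<le> r a) \<longrightarrow> sub_det A k r c > 0"
  proof (induction c rule: wf_induct_rule[OF wf])
    case (1 c)
    show ?case
    proof (intro impI)
      assume c: "increasing k n c" and le: "\<forall>a<k. c a \<le> r a"
      have le_Suc: "c (Suc a) \<le> r (Suc a)" if "a < q" for a
        using le that by (simp add: k_def)
      note c_mono = increasing_mono[OF c] and c_less = increasing_less[OF c]
      have IH: "sub_det A k r c' > 0"
        if "increasing k n c'" "\<And>a. a < k \<Longrightarrow> c' a \<le> r a"
          "c 0 < c' 0 \<or> c' 0 = c 0 \<and> (\<Sum>b<k. c' b) < (\<Sum>b<k. c b)" for c'
        using 1[of c'] that c_less[of 0] increasing_less[OF that(1), of 0]
        by (auto simp: k_def diff_less_mono2)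
      have IHq: "sub_det A q (r \<circ> Suc) c' > 0"
        if "\<And>i j. i < j \<Longrightarrow> j < q \<Longrightarrow> c' i < c' j" "\<And>a. a < q \<Longrightarrow> c' a \<le> r (Suc a)" for c'
      proof (rule Suc.IH[OF r'])
        show "increasing q n c'"
          using that(1) le_less_trans[OF that(2) increasing_less[OF r', unfolded o_def]]
          by (intro increasingI)
      qed (use that in auto)
      show "sub_det A k r c > 0"
      proof (cases "\<forall>s. Suc s < k \<longrightarrow> c (Suc s) = Suc (c s)")
        case True
        have contig: "c b = c 0 + b" if "b < k" for b
          using that
        proof (induction b)
          case (Suc b)
          then show ?case using True[rule_format, of b] by simp
        qed simp
        show ?thesis
        proof (rule left_pos_lower_tri_contiguous[OF A pos r])
          show "c 0 + k \<le> n" using contig[of q] c_less[of q] by (simp add: k_def)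
        qed (use contig le in blast)+
      next
        case False
        then obtain s where s: "Suc s < k" "c (Suc s) \<noteq> Suc (c s)" by blast
        then have gap: "Suc (c s) < c (Suc s)" using c_mono[of s "Suc s"] by simp
        \<comment> \<open>\<open>d\<close> is \<open>c\<close> with the missing column
          \<open>Suc (c s)\<close> inserted at position \<open>m\<close>. Omitting position
          \<open>m\<close> gives \<open>c\<close> back, omitting position 0 raises the first column,
          and omitting position \<open>Suc m\<close> keeps the first column and lowers the
          sum.\<close>
        define m where "m = Suc s"
        define d where "d b = (if b < m then c b else if b = m then Suc (c s) else c (b - 1))" for b
        have m: "0 < m" "m < k" using s by (auto simp: m_def)
        have d_step: "d b < d (Suc b)" if "b < k" for b
          using that gap c_mono[of b "Suc b"] c_mono[of "b - 1" b] s(1) by (auto simp: d_def m_def less_Suc_eq)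
        have d_mono: "d i < d j" if "i < j" "j \<le> k" for i j
          using that
        proof (induction j)
          case (Suc j)
          then show ?case using d_step[of j] by (cases "i = j") (auto intro: less_trans)
        qed simp
        have d_less: "d b < n" if "b \<le> k" for b
        proof -
          have "d b \<le> d k" using that d_mono[of b k] by (cases "b = k") auto
          also have "d k < n" using m c_less[of "k - 1"] by (auto simp: d_def)
          finally show ?thesis .
        qed
        have c_eq: "sub_det A k r (d \<circ> insert_index m) = sub_det A k r c"
          by (rule sub_det_cong) (auto simp: d_def insert_index_def)
        have p1: "sub_det A q (r \<circ> Suc) (\<lambda>b. d (Suc (insert_index m b))) > 0"
        proof (rule IHq)
          show "d (Suc (insert_index m i)) < d (Suc (insert_index m j))" if "i < j" "j < q" for i j
            using that by (intro d_mono) (auto simp: insert_index_def k_def)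
          show "d (Suc (insert_index m a)) \<le> r (Suc a)" if "a < q" for a
            using that le_Suc[of a] gap
            by (auto simp: insert_index_def d_def k_def m_def less_Suc_eq)
        qed
        have p2: "sub_det A q (r \<circ> Suc) (\<lambda>b. if b < m then d b else d (Suc (Suc b))) > 0"
        proof (rule IHq)
          show "(if i < m then d i else d (Suc (Suc i))) < (if j < m then d j else d (Suc (Suc j)))"
            if "i < j" "j < q" for i j
            using that d_mono[of i j] d_mono[of i "Suc (Suc j)"] d_mono[of "Suc (Suc i)" "Suc (Suc j)"]
            by (auto simp: k_def)
          show "(if a < m then d a else d (Suc (Suc a))) \<le> r (Suc a)" if "a < q" for a
            using that le_Suc[of a] c_mono[of a "Suc a"] by (auto simp: d_def k_def)
        qed
        have p3: "sub_det A q (r \<circ> Suc) (\<lambda>b. d (Suc (insert_index (m - 1) b))) > 0"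
        proof (rule IHq)
          show "d (Suc (insert_index (m - 1) i)) < d (Suc (insert_index (m - 1) j))" if "i < j" "j < q" for i j
            using that by (intro d_mono) (auto simp: insert_index_def k_def)
          show "d (Suc (insert_index (m - 1) a)) \<le> r (Suc a)" if "a < q" for a
            using that le_Suc[of a]
            by (auto simp: insert_index_def d_def k_def m_def)
        qed
        have incr_Suc: "increasing k n (d \<circ> Suc)"
          using d_mono d_less by (intro increasingI) auto
        \<comment> \<open>Raising the columns may push one beyond its row; the minor then vanishes.
          A weak inequality is enough here because the other summand of the relation is strictly
          positive.\<close>
        have p4: "sub_det A k r (d \<circ> Suc) \<ge> 0"
        proof (cases "\<forall>a<k. d (Suc a) \<le> r a")
          case True
          have "c 0 < d (Suc 0)" using d_mono[of 0 "Suc 0"] m by (auto simp: d_def)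
          then show ?thesis using IH[OF incr_Suc] True by (simp add: less_imp_le)
        next
          case False
          then obtain a where "a < k" "r a < (d \<circ> Suc) a" by (auto simp: not_le)
          then show ?thesis using sub_det_lower_tri_zero[OF A r incr_Suc] by simp
        qed
        have p5: "sub_det A k r (d \<circ> insert_index (Suc m)) > 0"
        proof (rule IH)
          show "increasing k n (d \<circ> insert_index (Suc m))"
            using d_mono d_less by (intro increasingI) (auto simp: insert_index_def)
          have le_c: "(d \<circ> insert_index (Suc m)) a \<le> c a" if "a < k" for a
            using that gap by (auto simp: insert_index_def d_def m_def less_Suc_eq)
          then show "(d \<circ> insert_index (Suc m)) a \<le> r a" if "a < k" for a
            using that le le_trans by blast
          have "(\<Sum>b<k. (d \<circ> insert_index (Suc m)) b) < (\<Sum>b<k. c b)"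
          proof (rule sum_strict_mono_ex1)
            show "\<exists>a\<in>{..<k}. (d \<circ> insert_index (Suc m)) a < c a"
              using m gap by (intro bexI[of _ m]) (auto simp: insert_index_def d_def m_def)
          qed (use le_c in auto)
          moreover have "(d \<circ> insert_index (Suc m)) 0 = c 0"
            using m by (auto simp: insert_index_def d_def)
          ultimately show "c 0 < (d \<circ> insert_index (Suc m)) 0 \<or> (d \<circ> insert_index (Suc m)) 0 = c 0 \<and>
              (\<Sum>b<k. (d \<circ> insert_index (Suc m)) b) < (\<Sum>b<k. c b)" by blast
        qed
        have "sub_det A q (r \<circ> Suc) (\<lambda>b. d (Suc (insert_index m b))) * sub_det A k r c > 0"
          using sub_det_three_term[OF k_def m, of A r d] p2 p3 p4 p5
          by (simp add: c_eq add_nonneg_pos)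
        then show ?thesis using p1 by (simp add: zero_less_mult_iff)
      qed
    qed
  qed
  then show ?case using Suc.prems by (simp add: k_def)
qed

subsection \<open>Jacobi's complementary minor identity\<close>

lemma sub_det_scale:
  fixes A :: "'a::comm_ring_1 mat"
  assumes "\<And>i. i < k \<Longrightarrow> r i < n" "\<And>j. j < k \<Longrightarrow> c j < m"
  shows "sub_det (mat n m (\<lambda>(i, j). f i * g j * A $$ (i, j))) k r c
    = (\<Prod>i<k. f (r i)) * (\<Prod>j<k. g (c j)) * sub_det A k r c"
proof -
  have "signof p * (\<Prod>i = 0..<k. f (r i) * g (c (p i)) * A $$ (r i, c (p i)))
      = (\<Prod>i<k. f (r i)) * (\<Prod>j<k. g (c j)) * (signof p * (\<Prod>i = 0..<k. A $$ (r i, c (p i))))"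
    if p: "p permutes {0..<k}" for p
  proof -
    have "(\<Prod>i = 0..<k. g (c (p i))) = (\<Prod>j<k. g (c j))"
      using prod.permute[OF p, of "\<lambda>j. g (c j)"] by (simp add: lessThan_atLeast0 o_def)
    then show ?thesis by (simp add: prod.distrib lessThan_atLeast0 mult_ac)
  qed
  then show ?thesis
    unfolding sub_det_def using assms
    by (auto simp: det_def'[of _ k] permutes_lt sum_distrib_left intro!: sum.cong)
qed

definition complementary :: "nat \<Rightarrow> nat \<Rightarrow> (nat \<Rightarrow> nat) \<Rightarrow> (nat \<Rightarrow> nat) \<Rightarrow> bool" where
  "complementary n k r s \<longleftrightarrow> increasing k n r \<and> increasing (n - k) n s \<and> r ` {..<k} \<inter> s ` {..<n - k} = {}"

text \<open>The values of \<open>r\<close> followed by those of \<open>s\<close>; being the identity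
  from \<open>n\<close> on makes it a permutation in the sense of \<open>permutes\<close>.\<close>

definition shuffle :: "nat \<Rightarrow> nat \<Rightarrow> (nat \<Rightarrow> nat) \<Rightarrow> (nat \<Rightarrow> nat) \<Rightarrow> nat \<Rightarrow> nat" where
  "shuffle n k r s i = (if i < k then r i else if i < n then s (i - k) else i)"

lemma complementary_exists:
  assumes r: "increasing k n r" obtains s where "complementary n k r s"
proof
  let ?I = "{..<n} - r ` {..<k}"
  have "card ?I = n - k"
    using r by (subst card_Diff_subset) (auto simp: card_image increasing_inj increasing_def)
  then have "increasing (n - k) n (pick ?I)" using increasing_pick[of ?I n] by auto
  moreover have "pick ?I ` {..<n - k} = ?I" using pick_image[of ?I] \<open>card ?I = n - k\<close> by simp
  ultimately show "complementary n k r (pick ?I)" using r by (auto simp: complementary_def)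
qed

lemma complementary_union:
  assumes "complementary n k r s" shows "r ` {..<k} \<union> s ` {..<n - k} = {..<n}"
proof (rule card_subset_eq)
  have "card (r ` {..<k} \<union> s ` {..<n - k}) = k + (n - k)"
    using assms by (subst card_Un_disjoint) (auto simp: complementary_def card_image increasing_inj)
  then show "card (r ` {..<k} \<union> s ` {..<n - k}) = card {..<n}"
    using assms increasing_le[of k n r] by (simp add: complementary_def)
qed (use assms in \<open>auto simp: complementary_def increasing_def\<close>)

lemma shuffle_permutes:
  assumes c: "complementary n k r s" shows "shuffle n k r s permutes {0..<n}"
proof (rule bij_imp_permutes)
  have k: "k \<le> n" using c increasing_le by (auto simp: complementary_def)
  have "{..<n} \<subseteq> shuffle n k r s ` {0..<n}"
  proof
    fix x assume "x \<in> {..<n}"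
    then consider i where "i < k" "x = r i" | j where "j < n - k" "x = s j"
      using complementary_union[OF c] by blast
    then show "x \<in> shuffle n k r s ` {0..<n}"
    proof cases
      case 1
      then show ?thesis using k by (intro image_eqI[of _ _ i]) (auto simp: shuffle_def)
    next
      case 2
      then show ?thesis using k by (intro image_eqI[of _ _ "k + j"]) (auto simp: shuffle_def)
    qed
  qed
  then have "{0..<n} \<subseteq> shuffle n k r s ` {0..<n}" by (simp add: lessThan_atLeast0)
  moreover have "shuffle n k r s ` {0..<n} \<subseteq> {0..<n}"
    using c increasing_less[of k n r] increasing_less[of "n - k" n s]
    by (auto simp: shuffle_def complementary_def)
  ultimately have img: "shuffle n k r s ` {0..<n} = {0..<n}" by blast
  then show "bij_betw (shuffle n k r s) {0..<n} {0..<n}"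
    using eq_card_imp_inj_on[of "{0..<n}" "shuffle n k r s"] by (simp add: bij_betw_def)
next
  fix x assume "x \<notin> {0..<n}"
  then show "shuffle n k r s x = x"
    using c increasing_le[of k n r] by (auto simp: shuffle_def complementary_def)
qed

text \<open>Induction on the sum of \<open>r\<close>: lowering one value by 1 is an adjacent
  transposition of values and negates both sides. At the minimum \<open>r\<close> is the identity on
  its positions, and the shuffle is \<open>id\<close>.\<close>

lemma sign_shuffle:
  assumes "complementary n k r s"
  shows "sign (shuffle n k r s) = (\<Prod>i<k. (- 1) ^ (r i + i))"
  using assms
proof (induction "\<Sum>i<k. r i" arbitrary: r s rule: less_induct)
  case less
  note c = less.prems
  have r: "increasing k n r" and s: "increasing (n - k) n s"
    and disj: "\<And>i j. i < k \<Longrightarrow> j < n - k \<Longrightarrow> r i \<noteq> s j"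
    using c by (auto simp: complementary_def)
  note r_mono = increasing_mono[OF r] and s_mono = increasing_mono[OF s]
  note r_less = increasing_less[OF r] and s_less = increasing_less[OF s]
  have k: "k \<le> n" using r by (rule increasing_le)
  show ?case
  proof (cases "\<forall>i<k. r i = i")
    case True
    have "s j = k + j" if j: "j < n - k" for j
    proof -
      have "k \<le> s 0"
      proof (rule ccontr)
        assume "\<not> k \<le> s 0"
        moreover have "0 < n - k" using j by simp
        ultimately show False using True disj[of "s 0" 0] by simp
      qed
      moreover have "s 0 + j \<le> s (0 + j)" using j by (intro increasing_ge_add[OF s]) simp
      moreover have "s j \<le> n - (n - k) + j" using j by (rule increasing_le_top[OF s])
      ultimately show ?thesis using k by simp
    qed
    then have "shuffle n k r s = id" using True by (auto simp: shuffle_def fun_eq_iff)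
    then show ?thesis using True by (simp add: mult_2[symmetric] power_mult)
  next
    case False
    \<comment> \<open>At the first \<open>a\<close> with \<open>r a \<noteq> a\<close>, the value
      \<open>r a - 1\<close> is not taken by \<open>r\<close>: earlier values are below
      \<open>a\<close>, later ones exceed \<open>r a\<close>. So it is a value of \<open>s\<close>
      and can be exchanged with \<open>r a\<close>.\<close>
    define a where "a = (LEAST a. a < k \<and> r a \<noteq> a)"
    have a: "a < k" "r a \<noteq> a" using LeastI_ex[of "\<lambda>a. a < k \<and> r a \<noteq> a"] False by (auto simp: a_def)
    have below: "r b = b" if "b < a" for b
      using not_less_Least[of b "\<lambda>a. a < k \<and> r a \<noteq> a"] that a by (auto simp: a_def)
    have ra: "a < r a" using increasing_ge[OF r a(1)] a(2) by simp
    define v where "v = r a - 1"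
    have v: "r a = Suc v" "a \<le> v" using ra by (auto simp: v_def)
    have v_notin: "r i \<noteq> v" if "i < k" for i
    proof (cases "i < a")
      case True
      then show ?thesis using below[of i] v by simp
    next
      case False
      then have "r a \<le> r i" using r_mono[of a i] that by (cases "i = a") auto
      then show ?thesis using v by simp
    qed
    define r' where "r' = r(a := v)"
    define s' where "s' j = (if s j = v then Suc v else s j)" for j
    have r': "increasing k n r'"
    proof (rule increasingI)
      fix i j assume "i < j" "j < k"
      then show "r' i < r' j"
        using r_mono[of i j] r_mono[of a j] below[of i] v a(1) by (auto simp: r'_def)
    next
      fix i assume "i < k"
      then show "r' i < n" using r_less[of i] v by (auto simp: r'_def)
    qed
    have s': "increasing (n - k) n s'"
    proof (rule increasingI)
      fix i j assume "i < j" "j < n - k"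
      then show "s' i < s' j"
        using s_mono[of i j] disj[of a j] v a(1) by (auto simp: s'_def)
    next
      fix i assume "i < n - k"
      then show "s' i < n" using s_less[of i] r_less[OF a(1)] v by (auto simp: s'_def)
    qed
    have r_eq: "r i = Suc v \<longleftrightarrow> i = a" if "i < k" for i
      using inj_on_eq_iff[OF increasing_inj[OF r], of i a] that a v by simp
    have "r' i \<noteq> s' j" if "i < k" "j < n - k" for i j
      using that v_notin[of i] disj[of i j] r_eq[of i] by (auto simp: r'_def s'_def)
    then have c': "complementary n k r' s'"
      using r' s' unfolding complementary_def by blast
    have "(\<Sum>i<k. r' i) < (\<Sum>i<k. r i)"
      using a v by (intro sum_strict_mono_ex1) (auto simp: r'_def)
    then have IH: "sign (shuffle n k r' s') = (\<Prod>i<k. (- 1) ^ (r' i + i))"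
      using less.hyps[OF _ c'] by simp
    have "shuffle n k r s = Transposition.transpose v (Suc v) \<circ> shuffle n k r' s'"
    proof
      fix i
      show "shuffle n k r s i = (Transposition.transpose v (Suc v) \<circ> shuffle n k r' s') i"
      proof (cases "i < k")
        case True
        then show ?thesis
          using v v_notin[of i] r_eq[of i]
          by (auto simp: shuffle_def r'_def Transposition.transpose_def)
      next
        case False
        show ?thesis
        proof (cases "i < n")
          case True
          then show ?thesis
            using False v disj[of a "i - k"] a(1)
            by (auto simp: shuffle_def s'_def Transposition.transpose_def diff_less_mono)
        next
          case False
          then show ?thesis
            using v r_less[OF a(1)] k by (auto simp: shuffle_def Transposition.transpose_def)
        qed
      qed
    qed
    then have "sign (shuffle n k r s) = - sign (shuffle n k r' s')"
      using permutation_permutes[of "shuffle n k r' s'"] shuffle_permutes[OF c']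
      by (auto simp: sign_compose sign_swap_id permutation_swap_id)
    also have "\<dots> = (\<Prod>i<k. (- 1) ^ (r i + i))"
    proof -
      have "(\<Prod>i\<in>{..<k} - {a}. (- 1 :: int) ^ (r i + i)) = (\<Prod>i\<in>{..<k} - {a}. (- 1) ^ (r' i + i))"
        by (intro prod.cong) (auto simp: r'_def)
      then show ?thesis
        using a(1) v unfolding IH by (simp add: prod.remove[of _ a] r'_def)
    qed
    finally show ?thesis .
  qed
qed

text \<open>The idea is to take the determinant of \<open>A * N\<close>, where \<open>N\<close> consists of the first \<open>k\<close> columns of
  \<open>W\<close> followed by the unit vectors with index \<open>s 0, s 1, \<dots>\<close>.\<close>

lemma Jacobi_complementary:
  fixes A W :: "'a::idom mat"
  assumes A: "A \<in> carrier_mat n n" and W: "W \<in> carrier_mat n n" and AW: "A * W = 1\<^sub>m n"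
    and c: "complementary n k r s"
  shows "det A * ((\<Prod>i<k. (- 1) ^ (r i + i)) * sub_det W k r id) = sub_det A (n - k) (\<lambda>i. k + i) s"
proof -
  have r: "increasing k n r" and s: "increasing (n - k) n s"
    and disj: "\<And>i j. i < k \<Longrightarrow> j < n - k \<Longrightarrow> r i \<noteq> s j"
    using c by (auto simp: complementary_def)
  have k: "k \<le> n" using r by (rule increasing_le)
  define N :: "'a mat" where
    "N = mat n n (\<lambda>(i, j). if j < k then W $$ (i, j) else if i = s (j - k) then 1 else 0)"
  have N: "N \<in> carrier_mat n n" by (simp add: N_def)
  let ?\<rho> = "shuffle n k r s"
  have \<rho>: "?\<rho> permutes {0..<n}" by (rule shuffle_permutes[OF c])
  \<comment> \<open>Listing the rows of \<open>r\<close> first and those of \<open>s\<close> last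
    makes \<open>N\<close> block triangular with an identity block at the lower right.\<close>
  have "mat n n (\<lambda>(i, j). N $$ (?\<rho> i, j))
      = four_block_mat (mat k k (\<lambda>(i, j). W $$ (r i, id j))) (0\<^sub>m k (n - k))
          (mat (n - k) k (\<lambda>(i, j). W $$ (s i, j))) (1\<^sub>m (n - k))"
  proof (rule eq_matI)
    fix i j
    assume "i < dim_row (four_block_mat (mat k k (\<lambda>(i, j). W $$ (r i, id j))) (0\<^sub>m k (n - k))
          (mat (n - k) k (\<lambda>(i, j). W $$ (s i, j))) (1\<^sub>m (n - k)))"
      "j < dim_col (four_block_mat (mat k k (\<lambda>(i, j). W $$ (r i, id j))) (0\<^sub>m k (n - k))
          (mat (n - k) k (\<lambda>(i, j). W $$ (s i, j))) (1\<^sub>m (n - k)))"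
    then have ij: "i < n" "j < n" using k by auto
    have s_eq: "s (i - k) = s (j - k) \<longleftrightarrow> i = j" if "\<not> i < k" "\<not> j < k"
      using inj_on_eq_iff[OF increasing_inj[OF s], of "i - k" "j - k"] that ij by auto
    show "mat n n (\<lambda>(i, j). N $$ (?\<rho> i, j)) $$ (i, j)
        = four_block_mat (mat k k (\<lambda>(i, j). W $$ (r i, id j))) (0\<^sub>m k (n - k))
          (mat (n - k) k (\<lambda>(i, j). W $$ (s i, j))) (1\<^sub>m (n - k)) $$ (i, j)"
      using k ij permutes_lt[OF \<rho> ij(1)] disj[of i "j - k"] s_eq
      by (cases "i < k"; cases "j < k") (simp_all add: N_def shuffle_def diff_less_mono, arith)
  qed (use k in auto)
  then have "sub_det W k r id = det (mat n n (\<lambda>(i, j). N $$ (?\<rho> i, j)))"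
    by (simp add: sub_det_def det_four_block_mat_upper_right_zero[of _ k _ "n - k"])
  also have "\<dots> = signof ?\<rho> * det N" by (rule det_permute_rows[OF N \<rho>])
  finally have "of_int (sign ?\<rho>) * sub_det W k r id = of_int (sign ?\<rho> * sign ?\<rho>) * det N"
    by (simp only: of_int_mult mult.assoc)
  then have "of_int (sign ?\<rho>) * sub_det W k r id = det N"
    by (simp only: sign_idempotent of_int_1 mult_1_left)
  then have detN: "(\<Prod>i<k. (- 1) ^ (r i + i)) * sub_det W k r id = det N"
    by (simp add: sign_shuffle[OF c])
  \<comment> \<open>The first \<open>k\<close> columns of the product are unit vectors because
    \<open>A * W = 1\<^sub>m n\<close>; the others are the columns \<open>s 0\<close>,
    \<open>s 1\<close>, ... of \<open>A\<close>.\<close>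
  have entry: "(A * N) $$ (i, j) = (if j < k then 1\<^sub>m n $$ (i, j) else A $$ (i, s (j - k)))"
    if ij: "i < n" "j < n" for i j
  proof (cases "j < k")
    case True
    then have "col N j = col W j" using ij W by (intro eq_vecI) (auto simp: N_def)
    then have "(A * N) $$ (i, j) = (A * W) $$ (i, j)" using A N W ij by simp
    then show ?thesis using True AW by simp
  next
    case False
    then have sj: "s (j - k) < n" using ij k by (intro increasing_less[OF s]) auto
    have "(A * N) $$ (i, j) = (\<Sum>l = 0..<n. A $$ (i, l) * (if l = s (j - k) then 1 else 0))"
      using A N ij False by (auto simp: scalar_prod_def N_def intro!: sum.cong)
    also have "\<dots> = A $$ (i, s (j - k))" using sj by (simp add: sum.delta if_distrib cong: if_cong)
    finally show ?thesis using False by simp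
  qed
  have "A * N = four_block_mat (1\<^sub>m k) (mat k (n - k) (\<lambda>(i, j). A $$ (i, s j))) (0\<^sub>m (n - k) k)
      (mat (n - k) (n - k) (\<lambda>(i, j). A $$ (k + i, s j)))"
    using A N k entry by (intro eq_matI) (auto simp del: index_mult_mat(1))
  then have "det (A * N) = sub_det A (n - k) (\<lambda>i. k + i) s"
    by (simp add: sub_det_def det_four_block_mat_lower_left_zero[of _ k _ "n - k"])
  then show ?thesis unfolding detN by (simp add: det_mult[OF A N])
qed

text \<open>For real matrices this is conjugation by \<open>delta n\<close>, entry by entry.\<close>

definition alternate :: "nat \<Rightarrow> 'a::comm_ring_1 mat \<Rightarrow> 'a mat" where
  "alternate n A = mat n n (\<lambda>(i, j). (- 1) ^ (i + j) * A $$ (i, j))"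

text \<open>The sign that appears is exactly that of \<open>Jacobi_complementary\<close>.\<close>

lemma sub_det_alternate:
  assumes "\<And>i. i < k \<Longrightarrow> r i < n" "k \<le> n"
  shows "sub_det (alternate n A) k r id = (\<Prod>i<k. (- 1) ^ (r i + i)) * sub_det A k r id"
proof -
  have "alternate n A = mat n n (\<lambda>(i, j). (- 1) ^ i * (- 1) ^ j * A $$ (i, j))"
    by (simp add: alternate_def power_add)
  then show ?thesis
    using assms by (simp add: sub_det_scale prod.distrib power_add)
qed

text \<open>By Jacobi's identity the minor of \<open>alternate n W\<close>, times
  \<open>det P > 0\<close>, is a minor of \<open>P\<close> on its last \<open>n - k\<close> rows.
  These dominate any choice of columns, so that minor is positive.\<close>

lemma left_pos_alternate_inverse:
  assumes P: "lower_tri n P" "left_pos n P" and W: "W \<in> carrier_mat n n" and PW: "P * W = 1\<^sub>m n"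
  shows "left_pos n (alternate n W)"
  unfolding left_pos_def
proof (intro allI impI)
  fix k r assume r: "increasing k n r"
  have PC: "P \<in> carrier_mat n n" using P by (simp add: lower_tri_def)
  have k: "k \<le> n" using r by (rule increasing_le)
  obtain s where c: "complementary n k r s" by (rule complementary_exists[OF r])
  then have s: "increasing (n - k) n s" by (simp add: complementary_def)
  have detP: "det P > 0"
  proof -
    have "mat n n (\<lambda>(i, j). P $$ (id i, id j)) = P" using PC by (intro eq_matI) auto
    then have "sub_det P n id id = det P" by (simp only: sub_det_def)
    moreover have "0 < sub_det P n id id"
      using P(2) increasing_id[of n n] unfolding left_pos_def by blast
    ultimately show ?thesis by simp
  qed
  have "sub_det P (n - k) (\<lambda>i. k + i) s > 0"
  proof (rule left_pos_lower_tri_sub_det_pos[OF P _ s])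
    show "increasing (n - k) n (\<lambda>i. k + i)" by (auto intro!: increasingI)
    show "s a \<le> k + a" if "a < n - k" for a
      using increasing_le_top[OF s that] k by simp
  qed
  then have "det P * sub_det (alternate n W) k r id > 0"
    using Jacobi_complementary[OF PC W PW c] increasing_less[OF r] k by (simp add: sub_det_alternate)
  then show "sub_det (alternate n W) k r id > 0" using detP by (simp add: zero_less_mult_iff)
qed

subsection \<open>LU and QR decompositions\<close>

lemma inverse_matE:
  fixes A :: "'a::field mat"
  assumes "A \<in> carrier_mat n n" "det A \<noteq> 0"
  obtains B where "B \<in> carrier_mat n n" "A * B = 1\<^sub>m n" "B * A = 1\<^sub>m n"
  using det_non_zero_imp_unit[OF assms, of undefined] by (auto simp: Units_def ring_mat_simps)

lemma upper_triangular_below: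
  "A \<in> carrier_mat n n \<Longrightarrow> upper_triangular A \<Longrightarrow> j < i \<Longrightarrow> i < n \<Longrightarrow> A $$ (i, j) = 0"
  by auto

lemma index_mult_mat_sum:
  assumes "A \<in> carrier_mat n m" "B \<in> carrier_mat m l" "i < n" "j < l"
  shows "(A * B) $$ (i, j) = (\<Sum>x<m. A $$ (i, x) * B $$ (x, j))"
  using assms by (auto simp: scalar_prod_def lessThan_atLeast0 intro!: sum.cong)

lemma det_upper_triangular_prod:
  assumes "A \<in> carrier_mat n n" "upper_triangular A"
  shows "det A = (\<Prod>i<n. A $$ (i, i))"
  using assms by (simp add: det_upper_triangular[OF _ assms(1)] prod_list_diag_prod lessThan_atLeast0)

lemma lower_tri_transpose:
  "A \<in> carrier_mat n n \<Longrightarrow> lower_tri n (transpose_mat A) \<longleftrightarrow> upper_triangular A"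
  by (auto simp: lower_tri_def upper_triangular_def)

lemma upper_triangular_mult:
  fixes A B :: "'a::semiring_0 mat"
  assumes A: "A \<in> carrier_mat n n" "upper_triangular A" and B: "B \<in> carrier_mat n n" "upper_triangular B"
  shows "upper_triangular (A * B)"
proof (rule upper_triangularI)
  fix i j assume ij: "j < i" "i < dim_row (A * B)"
  then have "i < n" "j < n" using A by auto
  then have "(A * B) $$ (i, j) = (\<Sum>x = 0..<n. A $$ (i, x) * B $$ (x, j))"
    using A(1) B(1) by (auto simp: scalar_prod_def)
  also have "\<dots> = 0"
  proof (intro sum.neutral ballI)
    fix x assume "x \<in> {0..<n}"
    then show "A $$ (i, x) * B $$ (x, j) = 0"
      using ij \<open>i < n\<close> A B upper_triangularD[of A x i] upper_triangularD[of B j x] by (cases "x < i") auto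
  qed
  finally show "(A * B) $$ (i, j) = 0" .
qed

text \<open>Back substitution: in entry \<open>(i, j)\<close> of \<open>U * W\<close> the terms with
  \<open>x < i\<close> vanish by the shape of \<open>U\<close>, those with \<open>x > i\<close> by
  induction from the last row upwards.\<close>

lemma upper_triangular_inverse:
  fixes U W :: "'a::field mat"
  assumes U: "U \<in> carrier_mat n n" "upper_triangular U" and W: "W \<in> carrier_mat n n"
    and UW: "U * W = 1\<^sub>m n"
  shows "upper_triangular W" "\<And>i. i < n \<Longrightarrow> W $$ (i, i) = inverse (U $$ (i, i))"
proof -
  have "det U * det W = 1" using det_mult[OF U(1) W] UW by simp
  then have "(\<Prod>i<n. U $$ (i, i)) \<noteq> 0"
    using det_upper_triangular_prod[OF U] by (metis mult_zero_left zero_neq_one)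
  then have diag: "U $$ (i, i) \<noteq> 0" if "i < n" for i using that by auto
  have below: "W $$ (i, j) = 0" if "j < i" "i < n" for i j
    using that
  proof (induction "n - i" arbitrary: i rule: less_induct)
    case less
    have "0 = (U * W) $$ (i, j)" using less.prems UW by simp
    also have "\<dots> = (\<Sum>x<n. U $$ (i, x) * W $$ (x, j))"
      using U W less.prems by (intro index_mult_mat_sum[of _ n n _ n]) auto
    also have "\<dots> = (\<Sum>x\<in>{i}. U $$ (i, x) * W $$ (x, j))"
    proof (rule sum.mono_neutral_right)
      show "\<forall>x\<in>{..<n} - {i}. U $$ (i, x) * W $$ (x, j) = 0"
      proof
        fix x assume x: "x \<in> {..<n} - {i}"
        then consider "x < i" | "i < x" "x < n" by fastforce
        then show "U $$ (i, x) * W $$ (x, j) = 0"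
          using less U by cases (auto intro: upper_triangularD)
      qed
    qed (use less.prems in auto)
    finally show ?case using diag[of i] less.prems by simp
  qed
  then show "upper_triangular W" using W by (intro upper_triangularI) auto
  show "W $$ (i, i) = inverse (U $$ (i, i))" if i: "i < n" for i
  proof -
    have "1 = (U * W) $$ (i, i)" using i UW by simp
    also have "\<dots> = (\<Sum>x<n. U $$ (i, x) * W $$ (x, i))"
      using U W i by (intro index_mult_mat_sum) auto
    also have "\<dots> = (\<Sum>x\<in>{i}. U $$ (i, x) * W $$ (x, i))"
    proof (rule sum.mono_neutral_right)
      show "\<forall>x\<in>{..<n} - {i}. U $$ (i, x) * W $$ (x, i) = 0"
      proof
        fix x assume x: "x \<in> {..<n} - {i}"
        then consider "x < i" | "i < x" "x < n" by fastforce
        then show "U $$ (i, x) * W $$ (x, i) = 0"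
          using below[of i x] U i by cases (auto intro: upper_triangularD)
      qed
    qed (use i in auto)
    finally show ?thesis using diag[OF i] by (simp add: field_simps)
  qed
qed

text \<open>The first \<open>k\<close> columns of \<open>A * U\<close> are the first
  \<open>k\<close> columns of \<open>A\<close> times the leading block of \<open>U\<close>, whose
  determinant is the diagonal product.\<close>

lemma sub_det_mult_upper_triangular:
  fixes A U :: "'a::comm_ring_1 mat"
  assumes A: "A \<in> carrier_mat n n" and U: "U \<in> carrier_mat n n" "upper_triangular U"
    and r: "\<And>i. i < k \<Longrightarrow> r i < n" and k: "k \<le> n"
  shows "sub_det (A * U) k r id = sub_det A k r id * (\<Prod>i<k. U $$ (i, i))"
proof -
  let ?A = "mat k k (\<lambda>(i, j). A $$ (r i, j))" and ?U = "mat k k (\<lambda>(i, j). U $$ (i, j))"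
  have "mat k k (\<lambda>(i, j). (A * U) $$ (r i, j)) = ?A * ?U"
  proof (rule eq_matI)
    fix i j assume "i < dim_row (?A * ?U)" "j < dim_col (?A * ?U)"
    then have ij: "i < k" "j < k" by auto
    have "(A * U) $$ (r i, j) = (\<Sum>x<n. A $$ (r i, x) * U $$ (x, j))"
      using A U r ij k by (intro index_mult_mat_sum[of _ n n _ n]) auto
    also have "\<dots> = (\<Sum>x<k. A $$ (r i, x) * U $$ (x, j))"
      using ij k by (intro sum.mono_neutral_right) (auto simp: upper_triangular_below[OF U])
    also have "\<dots> = (?A * ?U) $$ (i, j)"
      using ij by (subst index_mult_mat_sum[of _ k k _ k]) auto
    finally show "mat k k (\<lambda>(i, j). (A * U) $$ (r i, j)) $$ (i, j) = (?A * ?U) $$ (i, j)"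
      using ij by simp
  qed auto
  moreover have "upper_triangular ?U"
    using k by (intro upper_triangularI) (auto simp: upper_triangular_below[OF U])
  ultimately show ?thesis
    unfolding sub_det_def by (simp add: det_mult[of _ k] det_upper_triangular_prod[of _ k])
qed

text \<open>Induction by bordering: the last row and column of \<open>A\<close> are split off, and
  the new pivot is positive as the quotient of two consecutive leading minors.\<close>

lemma LU_decomposition:
  fixes A :: "real mat"
  assumes "A \<in> carrier_mat n n" "\<And>k. k \<le> n \<Longrightarrow> sub_det A k id id > 0"
  shows "\<exists>L U. lower_tri n L \<and> (\<forall>i<n. L $$ (i, i) = 1) \<and> U \<in> carrier_mat n n \<and> upper_triangular U \<and>
    (\<forall>i<n. U $$ (i, i) > 0) \<and> A = L * U"
  using assms
proof (induction n arbitrary: A)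
  case 0
  then show ?case
    by (intro exI[of _ "1\<^sub>m 0"]) (auto simp: lower_tri_def)
next
  case (Suc n)
  obtain A1 b c d where "split_block A n n = (A1, b, c, d)" by (cases "split_block A n n") auto
  from split_block[OF this, of 1 1] Suc.prems(1)
  have blocks: "A1 \<in> carrier_mat n n" "b \<in> carrier_mat n 1" "c \<in> carrier_mat 1 n" "d \<in> carrier_mat 1 1"
    and A: "A = four_block_mat A1 b c d" by auto
  have sub_A1: "sub_det A k id id = sub_det A1 k id id" if "k \<le> n" for k
    unfolding sub_det_def A using that blocks by (intro arg_cong[where f = det] eq_matI) auto
  have "sub_det A1 k id id > 0" if "k \<le> n" for k
    unfolding sub_A1[OF that, symmetric] by (rule Suc.prems(2)) (use that in simp)
  from Suc.IH[OF blocks(1) this] obtain L U where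
    L: "lower_tri n L" "\<forall>i<n. L $$ (i, i) = 1" and
    U: "U \<in> carrier_mat n n" "upper_triangular U" "\<forall>i<n. U $$ (i, i) > 0" and A1: "A1 = L * U"
    by auto
  have LC: "L \<in> carrier_mat n n" using L by (simp add: lower_tri_def)
  have full: "sub_det M m id id = det M" if "M \<in> carrier_mat m m" for M :: "real mat" and m
  proof -
    have "mat m m (\<lambda>(i, j). M $$ (id i, id j)) = M" using that by (intro eq_matI) auto
    then show ?thesis by (simp only: sub_det_def)
  qed
  have pos: "det A1 > 0" "det A > 0"
    using Suc.prems sub_A1[of n] full[OF blocks(1)] full[of A "Suc n"]
    by (metis le_SucI order_refl)+
  then have "det L * det U > 0" using A1 det_mult[OF LC U(1)] by simp
  then have "det L \<noteq> 0" "det U \<noteq> 0" by auto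
  obtain Li where Li: "Li \<in> carrier_mat n n" "L * Li = 1\<^sub>m n"
    using inverse_matE[OF LC \<open>det L \<noteq> 0\<close>] by blast
  obtain Ui where Ui: "Ui \<in> carrier_mat n n" "Ui * U = 1\<^sub>m n"
    using inverse_matE[OF U(1) \<open>det U \<noteq> 0\<close>] by blast
  \<comment> \<open>\<open>x\<close> and \<open>y\<close> solve \<open>x * U = c\<close> and
    \<open>L * y = b\<close>; \<open>u\<close> is the Schur complement of \<open>A1\<close>.\<close>
  define x where "x = c * Ui"
  define y where "y = Li * b"
  define u where "u = d - x * y"
  define L' where "L' = four_block_mat L (0\<^sub>m n 1) x (1\<^sub>m 1)"
  define U' where "U' = four_block_mat U y (0\<^sub>m 1 n) u"
  have xyu: "x \<in> carrier_mat 1 n" "y \<in> carrier_mat n 1" "u \<in> carrier_mat 1 1"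
    using blocks Li Ui by (auto simp: x_def y_def u_def)
  have xU: "x * U = c"
    using assoc_mult_mat[OF blocks(3) Ui(1) U(1)] Ui(2) blocks(3) by (simp add: x_def)
  have Ly: "L * y = b"
    using assoc_mult_mat[OF LC Li(1) blocks(2)] Li(2) blocks(2) by (simp add: y_def)
  have xyu_d: "x * y + u = d"
    using blocks xyu by (intro eq_matI) (auto simp: u_def)
  have L'C: "L' \<in> carrier_mat (Suc n) (Suc n)" and U'C: "U' \<in> carrier_mat (Suc n) (Suc n)"
    using four_block_carrier_mat[of L n n "1\<^sub>m 1" 1 1] four_block_carrier_mat[of U n n u 1 1] LC U xyu
    by (auto simp: L'_def U'_def)
  have "L' * U' = four_block_mat (L * U + 0\<^sub>m n 1 * 0\<^sub>m 1 n) (L * y + 0\<^sub>m n 1 * u)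
      (x * U + 1\<^sub>m 1 * 0\<^sub>m 1 n) (x * y + 1\<^sub>m 1 * u)"
    unfolding L'_def U'_def using LC U xyu by (intro mult_four_block_mat) auto
  also have "\<dots> = A"
    unfolding A using xyu blocks LC U by (simp add: xU Ly A1 xyu_d)
  finally have LU: "A = L' * U'" by simp
  have "det L' = det L" unfolding L'_def using LC xyu
    by (subst det_four_block_mat_upper_right_zero[of _ n _ 1]) auto
  moreover have "det U' = det U * det u" unfolding U'_def using U xyu
    by (intro det_four_block_mat_lower_left_zero) auto
  ultimately have "det A = det A1 * det u"
    using det_mult[OF L'C U'C] det_mult[OF LC U(1)] by (simp add: LU A1)
  moreover have "det u = u $$ (0, 0)" using xyu(3) by (rule det_single)
  ultimately have u_pos: "u $$ (0, 0) > 0" using pos by (simp add: zero_less_mult_iff)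
  have "lower_tri (Suc n) L'"
    using L L'C xyu by (auto simp: lower_tri_def L'_def)
  moreover have "\<forall>i<Suc n. L' $$ (i, i) = 1"
    using L LC xyu by (auto simp: L'_def less_Suc_eq)
  moreover have "upper_triangular U'"
    using U xyu unfolding U'_def by (intro upper_triangular_four_block) (auto simp: upper_triangular_def)
  moreover have "\<forall>i<Suc n. U' $$ (i, i) > 0"
    using U xyu u_pos by (auto simp: U'_def less_Suc_eq)
  ultimately show ?case using U'C LU by blast
qed

text \<open>Right multiplication by \<open>U\<close> only scales left-justified minors by positive
  factors, so those of \<open>L\<close> have the signs of those of \<open>A\<close>.\<close>

lemma left_pos_LU:
  assumes A: "A \<in> carrier_mat n n" "left_pos n A"
  obtains L U where "lower_tri n L" "left_pos n L" "\<And>i. i < n \<Longrightarrow> L $$ (i, i) = 1" "U \<in> carrier_mat n n" "upper_triangular U"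
    "\<And>i. i < n \<Longrightarrow> U $$ (i, i) > 0" "A = L * U"
proof -
  have "sub_det A k id id > 0" if "k \<le> n" for k
    using A(2) increasing_id[OF that] unfolding left_pos_def by blast
  from LU_decomposition[OF A(1) this] obtain L U where
    L: "lower_tri n L" "\<forall>i<n. L $$ (i, i) = 1" and
    U: "U \<in> carrier_mat n n" "upper_triangular U" "\<forall>i<n. U $$ (i, i) > 0"
    and LU: "A = L * U" by auto
  have "left_pos n L"
    unfolding left_pos_def
  proof (intro allI impI)
    fix k r assume r: "increasing k n r"
    have k: "k \<le> n" using r by (rule increasing_le)
    have "sub_det A k r id = sub_det L k r id * (\<Prod>i<k. U $$ (i, i))"
      unfolding LU using L U r k
      by (intro sub_det_mult_upper_triangular) (auto simp: lower_tri_def increasing_less)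
    moreover have "sub_det A k r id > 0" using A r by (simp add: left_pos_def)
    moreover have "(\<Prod>i<k. U $$ (i, i)) > 0" using U k by (intro prod_pos) auto
    ultimately show "sub_det L k r id > 0" by (simp add: zero_less_mult_iff)
  qed
  then show thesis using that L U LU by blast
qed

lemma left_pos_mult_upper_triangular:
  assumes A: "A \<in> carrier_mat n n" and U: "U \<in> carrier_mat n n" "upper_triangular U"
    and pos: "\<And>i. i < n \<Longrightarrow> U $$ (i, i) > 0"
  shows "left_pos n (A * U) \<longleftrightarrow> left_pos n A"
proof -
  have "sub_det (A * U) k r id > 0 \<longleftrightarrow> sub_det A k r id > 0" if r: "increasing k n r" for k r
  proof -
    have k: "k \<le> n" using r by (rule increasing_le)
    have "sub_det (A * U) k r id = sub_det A k r id * (\<Prod>i<k. U $$ (i, i))"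
      using A U r k by (intro sub_det_mult_upper_triangular) (auto simp: increasing_less)
    moreover have "(\<Prod>i<k. U $$ (i, i)) > 0" using pos k by (intro prod_pos) auto
    ultimately show ?thesis by (simp add: zero_less_mult_iff)
  qed
  then show ?thesis by (simp add: left_pos_def)
qed

section \<open>Gram matrices and the QR decomposition\<close>

lemma sub_det_gram:
  assumes A: "A \<in> carrier_mat n n" and k: "k \<le> n"
  shows "sub_det (transpose_mat A * A) k id id = (\<Sum>K | K \<subseteq> {..<n} \<and> card K = k. (sub_det A k (pick K) id)\<^sup>2)"
proof -
  let ?K = "{K. K \<subseteq> {..<n} \<and> card K = k}"
  have "sub_det (transpose_mat A * A) k id id
      = (\<Sum>K\<in>?K. sub_det (transpose_mat A) k id (pick K) * sub_det A k (pick K) id)"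
    using A k by (intro Cauchy_Binet[of _ n n _ n]) auto
  also have "\<dots> = (\<Sum>K\<in>?K. (sub_det A k (pick K) id)\<^sup>2)"
  proof (rule sum.cong[OF refl])
    fix K assume "K \<in> ?K"
    then show "sub_det (transpose_mat A) k id (pick K) * sub_det A k (pick K) id = (sub_det A k (pick K) id)\<^sup>2"
      using A k increasing_less[OF increasing_pick[of K n]]
      by (subst sub_det_transpose[of _ n n]) (auto simp: power2_eq_square)
  qed
  finally show ?thesis .
qed

text \<open>By \<open>sub_det_gram\<close> this is a sum of squares of left-justified minors of
  \<open>A\<close>, which are all nonzero.\<close>

lemma left_pos_gram_minors:
  assumes A: "A \<in> carrier_mat n n" "left_pos n A" and k: "k \<le> n"
  shows "sub_det (transpose_mat A * A) k id id > 0"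
  unfolding sub_det_gram[OF A(1) k]
proof (rule sum_pos)
  let ?K = "{K. K \<subseteq> {..<n} \<and> card K = k}"
  show "finite ?K" by (rule finite_subset[of _ "Pow {..<n}"]) auto
  show "?K \<noteq> {}" using k by (auto intro!: exI[of _ "{..<k}"])
  show "(sub_det A k (pick K) id)\<^sup>2 > 0" if "K \<in> ?K" for K
    using that A(2) increasing_pick[of K n] unfolding left_pos_def by fastforce
qed

text \<open>With the LU decomposition of the Gram matrix of \<open>A\<close> and \<open>V\<close>
  inverse to \<open>U\<close>, the columns of \<open>G = A * V\<close> are pairwise orthogonal;
  normalising them gives \<open>Q\<close>.\<close>

lemma left_pos_QR:
  assumes A: "A \<in> carrier_mat n n" "left_pos n A"
  obtains Q R where "Q \<in> carrier_mat n n" "transpose_mat Q * Q = 1\<^sub>m n" "R \<in> carrier_mat n n"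
    "upper_triangular R" "\<And>i. i < n \<Longrightarrow> R $$ (i, i) > 0" "A = Q * R"
proof -
  let ?S = "transpose_mat A * A"
  have SC: "?S \<in> carrier_mat n n" using A by auto
  from LU_decomposition[OF SC left_pos_gram_minors[OF A]] obtain L U where
    L: "lower_tri n L" "\<forall>i<n. L $$ (i, i) = 1" and
    U: "U \<in> carrier_mat n n" "upper_triangular U" "\<forall>i<n. U $$ (i, i) > 0" and S: "?S = L * U"
    by auto
  have LC: "L \<in> carrier_mat n n" using L by (simp add: lower_tri_def)
  have "det U > 0" using U by (auto simp: det_upper_triangular_prod intro!: prod_pos)
  then obtain V where V: "V \<in> carrier_mat n n" "U * V = 1\<^sub>m n" "V * U = 1\<^sub>m n"
    using inverse_matE[OF U(1)] by force
  have V_upper: "upper_triangular V" and V_diag: "\<And>i. i < n \<Longrightarrow> V $$ (i, i) > 0"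
    using upper_triangular_inverse[OF U(1,2) V(1,2)] U(3) by auto
  define G where "G = A * V"
  define D where "D = transpose_mat G * G"
  have GC: "G \<in> carrier_mat n n" and DC: "D \<in> carrier_mat n n" using A V by (auto simp: G_def D_def)
  have "D = transpose_mat V * (?S * V)"
    using A V unfolding D_def G_def
    by (simp add: transpose_mult[of _ n n] assoc_mult_mat[of _ n n _ n _ n])
  also have "?S * V = L * (U * V)" unfolding S using LC U V by (simp add: assoc_mult_mat[of _ n n _ n _ n])
  finally have D: "D = transpose_mat V * L" using LC V by simp
  \<comment> \<open>As a product of lower triangular matrices \<open>D\<close> is lower triangular;
    being a Gram matrix it is symmetric, hence diagonal.\<close>
  have D_sym: "D $$ (i, j) = D $$ (j, i)" if "i < n" "j < n" for i j
  proof -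
    have "transpose_mat D = D" using GC by (simp add: D_def transpose_mult[of _ n n])
    then show ?thesis using that DC by (metis carrier_matD index_transpose_mat(1))
  qed
  have D_entry: "D $$ (i, j) = (\<Sum>x<n. V $$ (x, i) * L $$ (x, j))" if "i < n" "j < n" for i j
    using that V LC by (subst D, subst index_mult_mat_sum[of _ n n _ n]) auto
  have D_upper: "D $$ (i, j) = 0" if "i < j" "j < n" for i j
  proof -
    have "V $$ (x, i) * L $$ (x, j) = 0" if "x < n" for x
      using that \<open>i < j\<close> \<open>j < n\<close> V_upper V(1) L(1)
      by (cases "x < j") (auto simp: lower_tri_def intro: upper_triangularD)
    then show ?thesis using that by (simp add: D_entry sum.neutral del: mult_eq_0_iff)
  qed
  have D_off: "D $$ (i, j) = 0" if "i \<noteq> j" "i < n" "j < n" for i j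
    using that D_upper[of i j] D_upper[of j i] D_sym[of i j] by (cases "i < j") auto
  have D_diag: "D $$ (i, i) > 0" if i: "i < n" for i
  proof -
    have "D $$ (i, i) = (\<Sum>x\<in>{i}. V $$ (x, i) * L $$ (x, i))"
      unfolding D_entry[OF i i]
    proof (rule sum.mono_neutral_right)
      show "\<forall>x\<in>{..<n} - {i}. V $$ (x, i) * L $$ (x, i) = 0"
      proof
        fix x assume "x \<in> {..<n} - {i}"
        then show "V $$ (x, i) * L $$ (x, i) = 0"
          using i V_upper V(1) L(1) by (cases "x < i") (auto simp: lower_tri_def intro: upper_triangularD)
      qed
    qed (use i in auto)
    then show ?thesis using V_diag[OF i] L i by simp
  qed
  \<comment> \<open>\<open>sqrt (D $$ (j, j))\<close> is the norm of column \<open>j\<close> of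
    \<open>G\<close>; \<open>R\<close> takes up these factors row by row, so that
    \<open>Q * R = G * U\<close>.\<close>
  define Q where "Q = mat n n (\<lambda>(i, j). G $$ (i, j) / sqrt (D $$ (j, j)))"
  define R where "R = mat n n (\<lambda>(i, j). sqrt (D $$ (i, i)) * U $$ (i, j))"
  have QC: "Q \<in> carrier_mat n n" and RC: "R \<in> carrier_mat n n" by (auto simp: Q_def R_def)
  have "transpose_mat Q * Q = 1\<^sub>m n"
  proof (rule eq_matI)
    fix i j assume "i < dim_row (1\<^sub>m n :: real mat)" "j < dim_col (1\<^sub>m n :: real mat)"
    then have ij: "i < n" "j < n" by auto
    have "(transpose_mat Q * Q) $$ (i, j) = (\<Sum>x<n. G $$ (x, i) / sqrt (D $$ (i, i)) * (G $$ (x, j) / sqrt (D $$ (j, j))))"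
      using ij QC by (subst index_mult_mat_sum[of _ n n _ n]) (auto simp: Q_def)
    also have "\<dots> = (\<Sum>x<n. G $$ (x, i) * G $$ (x, j)) / (sqrt (D $$ (i, i)) * sqrt (D $$ (j, j)))"
      by (simp add: sum_divide_distrib)
    also have "(\<Sum>x<n. G $$ (x, i) * G $$ (x, j)) = D $$ (i, j)"
      unfolding D_def using ij GC by (subst index_mult_mat_sum[of _ n n _ n]) auto
    also have "D $$ (i, j) / (sqrt (D $$ (i, i)) * sqrt (D $$ (j, j))) = 1\<^sub>m n $$ (i, j)"
      using ij D_off[of i j] D_diag[of i] by (cases "i = j") auto
    finally show "(transpose_mat Q * Q) $$ (i, j) = 1\<^sub>m n $$ (i, j)" .
  qed (use QC in auto)
  moreover have "upper_triangular R"
    by (intro upper_triangularI) (auto simp: R_def upper_triangular_below[OF U(1,2)])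
  moreover have "R $$ (i, i) > 0" if "i < n" for i using that U D_diag by (simp add: R_def)
  moreover have "A = Q * R"
  proof -
    have "Q * R = G * U"
    proof (rule eq_matI)
      fix i j assume "i < dim_row (G * U)" "j < dim_col (G * U)"
      then have ij: "i < n" "j < n" using GC U by auto
      have "(Q * R) $$ (i, j) = (\<Sum>x<n. Q $$ (i, x) * R $$ (x, j))"
        using ij QC RC by (intro index_mult_mat_sum)
      also have "\<dots> = (\<Sum>x<n. G $$ (i, x) * U $$ (x, j))"
        using ij D_diag by (intro sum.cong refl) (auto simp: Q_def R_def less_imp_neq[symmetric])
      also have "\<dots> = (G * U) $$ (i, j)" by (rule index_mult_mat_sum[OF GC U(1) ij, symmetric])
      finally show "(Q * R) $$ (i, j) = (G * U) $$ (i, j)" .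
    qed (use QC RC GC U in auto)
    also have "\<dots> = A * (V * U)" unfolding G_def using A V U by (intro assoc_mult_mat) auto
    finally show ?thesis using A V by simp
  qed
  ultimately show thesis using that QC RC by blast
qed

subsection \<open>Totally positive flags\<close>

lemma lower_tri_sub_det_nonneg:
  assumes "lower_tri n L" "left_pos n L" "increasing k n r" "increasing k n c"
  shows "sub_det L k r c \<ge> 0"
proof (cases "\<forall>a<k. c a \<le> r a")
  case True
  then show ?thesis using left_pos_lower_tri_sub_det_pos[OF assms] by (simp add: less_imp_le)
next
  case False
  then obtain s where "s < k" "r s < c s" by (auto simp: not_le)
  then show ?thesis using sub_det_lower_tri_zero[OF assms(1,3,4)] by simp
qed

text \<open>In the Cauchy-Binet sum all terms are nonnegative, and \<open>K = {..<k}\<close>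
  contributes a product of two left-justified minors of \<open>L\<close>.\<close>

lemma lower_tri_mult_transpose_GL_pos:
  assumes L: "lower_tri n L" "left_pos n L"
  shows "L * transpose_mat L \<in> GL_pos n"
proof -
  have LC: "L \<in> carrier_mat n n" using L by (simp add: lower_tri_def)
  have "minor (L * transpose_mat L) I J > 0"
    if I: "I \<subseteq> {..<n}" and J: "J \<subseteq> {..<n}" and card: "card I = card J" for I J
  proof -
    define k where "k = card I"
    let ?K = "{K. K \<subseteq> {..<n} \<and> card K = k}"
    have r: "increasing k n (pick I)" and c: "increasing k n (pick J)"
      using increasing_pick[OF I] increasing_pick[OF J] card by (simp_all add: k_def)
    have k: "k \<le> n" using r by (rule increasing_le)
    have "minor (L * transpose_mat L) I J = sub_det (L * transpose_mat L) k (pick I) (pick J)"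
      using LC I J card by (intro minor_eq_sub_det) (auto simp: k_def)
    also have "\<dots> = (\<Sum>K\<in>?K. sub_det L k (pick I) (pick K) * sub_det (transpose_mat L) k (pick K) (pick J))"
      using LC r c by (intro Cauchy_Binet) (auto simp: increasing_less)
    also have "\<dots> = (\<Sum>K\<in>?K. sub_det L k (pick I) (pick K) * sub_det L k (pick J) (pick K))"
    proof (rule sum.cong[OF refl])
      fix K assume "K \<in> ?K"
      then show "sub_det L k (pick I) (pick K) * sub_det (transpose_mat L) k (pick K) (pick J)
          = sub_det L k (pick I) (pick K) * sub_det L k (pick J) (pick K)"
        using LC increasing_less[OF increasing_pick[of K n]] increasing_less[OF c]
        by (subst sub_det_transpose[of _ n n]) auto
    qed
    also have "\<dots> > 0"
    proof (rule sum_pos2[of _ "{..<k}"])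
      show "finite ?K" by (rule finite_subset[of _ "Pow {..<n}"]) auto
      show "{..<k} \<in> ?K" using k by auto
      have "sub_det L k (pick I) (pick {..<k}) = sub_det L k (pick I) id"
        "sub_det L k (pick J) (pick {..<k}) = sub_det L k (pick J) id"
        by (auto intro!: sub_det_cong simp: pick_lessThan)
      then show "sub_det L k (pick I) (pick {..<k}) * sub_det L k (pick J) (pick {..<k}) > 0"
        using L(2) r c by (simp add: left_pos_def)
      show "sub_det L k (pick I) (pick K) * sub_det L k (pick J) (pick K) \<ge> 0" if "K \<in> ?K" for K
        using that L r c increasing_pick[of K n]
        by (intro mult_nonneg_nonneg lower_tri_sub_det_nonneg[of n]) auto
    qed
    finally show ?thesis .
  qed
  then show ?thesis using LC by (auto simp: GL_pos_def)
qed

text \<open>Here the positive Cauchy-Binet term is the one for the last \<open>k\<close> rows, which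
  dominate every choice of \<open>k\<close> columns.\<close>

lemma left_pos_transpose_mult_lower_tri:
  assumes L: "lower_tri n L" "left_pos n L"
  shows "left_pos n (transpose_mat L * L)"
  unfolding left_pos_def
proof (intro allI impI)
  fix k r assume r: "increasing k n r"
  let ?K = "{K. K \<subseteq> {..<n} \<and> card K = k}"
  have LC: "L \<in> carrier_mat n n" using L by (simp add: lower_tri_def)
  have k: "k \<le> n" using r by (rule increasing_le)
  have "sub_det (transpose_mat L * L) k r id
      = (\<Sum>K\<in>?K. sub_det (transpose_mat L) k r (pick K) * sub_det L k (pick K) id)"
    using LC r k by (intro Cauchy_Binet[of _ n n _ n]) (auto simp: increasing_less)
  also have "\<dots> = (\<Sum>K\<in>?K. sub_det L k (pick K) r * sub_det L k (pick K) id)"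
  proof (rule sum.cong[OF refl])
    fix K assume "K \<in> ?K"
    then show "sub_det (transpose_mat L) k r (pick K) * sub_det L k (pick K) id
        = sub_det L k (pick K) r * sub_det L k (pick K) id"
      using LC increasing_less[OF increasing_pick[of K n]] increasing_less[OF r]
      by (subst sub_det_transpose[of _ n n]) auto
  qed
  also have "\<dots> > 0"
  proof (rule sum_pos2[of _ "(+) (n - k) ` {..<k}"])
    have top: "increasing k n ((+) (n - k))" using k by (auto intro!: increasingI)
    show "finite ?K" by (rule finite_subset[of _ "Pow {..<n}"]) auto
    show "(+) (n - k) ` {..<k} \<in> ?K"
      using top card_image[OF increasing_inj[OF top]] by (simp add: increasing_def)
    have eq: "sub_det L k (pick ((+) (n - k) ` {..<k})) c = sub_det L k ((+) (n - k)) c" for c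
      by (rule sub_det_cong) (auto simp: pick_image_increasing[OF top])
    have "sub_det L k ((+) (n - k)) c > 0" if "increasing k n c" for c
      using increasing_le_top[OF that] by (intro left_pos_lower_tri_sub_det_pos[OF L top that])
    then show "sub_det L k (pick ((+) (n - k) ` {..<k})) r * sub_det L k (pick ((+) (n - k) ` {..<k})) id > 0"
      using r increasing_id[OF k] by (simp add: eq)
    show "sub_det L k (pick K) r * sub_det L k (pick K) id \<ge> 0" if "K \<in> ?K" for K
      using that L r increasing_id[OF k] increasing_pick[of K n]
      by (intro mult_nonneg_nonneg lower_tri_sub_det_nonneg[of n]) auto
  qed
  finally show "sub_det (transpose_mat L * L) k r id > 0" .
qed

section \<open>Sign conjugation and the twist on orthogonal matrices\<close>

lemma alternate_carrier [simp]: "alternate n A \<in> carrier_mat n n"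
  by (simp add: alternate_def)

lemma alternate_alternate: "A \<in> carrier_mat n n \<Longrightarrow> alternate n (alternate n A) = A"
  by (intro eq_matI) (auto simp: alternate_def mult.assoc[symmetric] power_add[symmetric] mult_2[symmetric] power_mult)

lemma alternate_transpose:
  "A \<in> carrier_mat n n \<Longrightarrow> transpose_mat (alternate n A) = alternate n (transpose_mat A)"
  by (intro eq_matI) (auto simp: alternate_def add.commute)

lemma alternate_one: "alternate n (1\<^sub>m n) = 1\<^sub>m n"
  by (intro eq_matI) (auto simp: alternate_def mult_2[symmetric] power_mult)

lemma alternate_mult:
  fixes A B :: "'a::comm_ring_1 mat"
  assumes A: "A \<in> carrier_mat n n" and B: "B \<in> carrier_mat n n"
  shows "alternate n (A * B) = alternate n A * alternate n B"
proof (rule eq_matI)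
  fix i j assume "i < dim_row (alternate n A * alternate n B)" "j < dim_col (alternate n A * alternate n B)"
  then have ij: "i < n" "j < n" by (auto simp: alternate_def)
  have sign: "(- 1) ^ (i + x) * (- 1) ^ (x + j) = (- 1 :: 'a) ^ (i + j)" for x
    by (simp add: power_add mult_ac)
  have "(alternate n A * alternate n B) $$ (i, j) = (\<Sum>x<n. alternate n A $$ (i, x) * alternate n B $$ (x, j))"
    by (rule index_mult_mat_sum[OF alternate_carrier alternate_carrier ij])
  also have "\<dots> = (\<Sum>x<n. ((- 1) ^ (i + x) * (- 1) ^ (x + j)) * (A $$ (i, x) * B $$ (x, j)))"
    using ij by (intro sum.cong refl) (simp add: alternate_def mult_ac)
  also have "\<dots> = (- 1) ^ (i + j) * (A * B) $$ (i, j)"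
    unfolding sign index_mult_mat_sum[OF A B ij] by (simp add: sum_distrib_left)
  finally show "alternate n (A * B) $$ (i, j) = (alternate n A * alternate n B) $$ (i, j)"
    using ij by (simp add: alternate_def)
qed (auto simp: alternate_def)

definition orth_pos :: "nat \<Rightarrow> real mat set" where
  "orth_pos n = {Q \<in> carrier_mat n n. transpose_mat Q * Q = 1\<^sub>m n \<and> left_pos n Q}"

lemma orth_pos_alternate_transpose:
  assumes "Q \<in> orth_pos n" shows "alternate n (transpose_mat Q) \<in> orth_pos n"
proof -
  have Q: "Q \<in> carrier_mat n n" "transpose_mat Q * Q = 1\<^sub>m n" "left_pos n Q"
    using assms by (auto simp: orth_pos_def)
  obtain L U where L: "lower_tri n L" "left_pos n L" "\<And>i. i < n \<Longrightarrow> L $$ (i, i) = 1"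
    and U: "U \<in> carrier_mat n n" "upper_triangular U" "\<And>i. i < n \<Longrightarrow> U $$ (i, i) > 0"
    and LU: "Q = L * U"
    using left_pos_LU[OF Q(1,3)] by blast
  have LC: "L \<in> carrier_mat n n" using L by (simp add: lower_tri_def)
  have "det U > 0" using U by (auto simp: det_upper_triangular_prod intro!: prod_pos)
  then obtain V where V: "V \<in> carrier_mat n n" "U * V = 1\<^sub>m n" "V * U = 1\<^sub>m n"
    using inverse_matE[OF U(1)] by force
  have V_upper: "upper_triangular V" and V_diag: "\<And>i. i < n \<Longrightarrow> V $$ (i, i) > 0"
    using upper_triangular_inverse[OF U(1,2) V(1,2)] U(3) by auto
  let ?P = "transpose_mat V"
  have PC: "?P \<in> carrier_mat n n" using V by simp
  have "Q * V = L * (U * V)" unfolding LU using LC U V by (intro assoc_mult_mat) auto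
  then have L_eq: "L = Q * V" using LC V by simp
  have "transpose_mat L * L = ?P * (transpose_mat Q * (Q * V))"
    unfolding L_eq using Q V by (simp add: transpose_mult[of _ n n] assoc_mult_mat[of _ n n _ n _ n])
  also have "transpose_mat Q * (Q * V) = (transpose_mat Q * Q) * V"
    using Q V by (intro assoc_mult_mat[symmetric]) auto
  \<comment> \<open>Orthogonality cancels \<open>Q\<close>. Since \<open>V\<close> is upper
    triangular with positive diagonal, positivity of left-justified minors passes from this product
    to \<open>?P\<close>.\<close>
  finally have "transpose_mat L * L = ?P * V" using Q V by simp
  then have "left_pos n ?P"
    using left_pos_transpose_mult_lower_tri[OF L(1,2)] left_pos_mult_upper_triangular[OF PC V(1) V_upper V_diag]
    by simp
  moreover have "lower_tri n ?P" using V V_upper by (simp add: lower_tri_transpose)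
  moreover have "?P * transpose_mat U = 1\<^sub>m n"
    using transpose_mult[OF U(1) V(1)] V(2) by simp
  ultimately have "left_pos n (alternate n (transpose_mat U))"
    using U by (intro left_pos_alternate_inverse) auto
  moreover have "alternate n (transpose_mat Q) = alternate n (transpose_mat U) * alternate n (transpose_mat L)"
    using LC U by (simp add: LU transpose_mult[of _ n n] alternate_mult)
  \<comment> \<open>The remaining factor is upper triangular with unit diagonal, so it preserves
    left-justified minors.\<close>
  moreover have "upper_triangular (alternate n (transpose_mat L))"
    using L LC by (intro upper_triangularI) (auto simp: alternate_def lower_tri_def)
  moreover have "alternate n (transpose_mat L) $$ (i, i) > 0" if "i < n" for i
    using that L LC by (simp add: alternate_def mult_2[symmetric] power_mult)
  ultimately have "left_pos n (alternate n (transpose_mat Q))"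
    by (simp add: left_pos_mult_upper_triangular)
  moreover have "transpose_mat (alternate n (transpose_mat Q)) * alternate n (transpose_mat Q) = 1\<^sub>m n"
  proof -
    have "Q * transpose_mat Q = 1\<^sub>m n"
      using mat_mult_left_right_inverse[of "transpose_mat Q" n Q] Q by simp
    then have "alternate n (Q * transpose_mat Q) = 1\<^sub>m n" by (simp add: alternate_one)
    then show ?thesis using Q by (simp add: alternate_mult alternate_transpose)
  qed
  ultimately show ?thesis by (simp add: orth_pos_def)
qed

section \<open>Flags as cosets of the Borel group\<close>

lemma carrier_GL: "carrier (GL n) = {g \<in> carrier_mat n n. det g \<noteq> 0}"
proof -
  have "g \<in> Units (ring_mat TYPE(complex) n ()) \<longleftrightarrow> g \<in> carrier_mat n n \<and> det g \<noteq> 0" for g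
    using unit_imp_det_non_zero[of g n "()"] det_non_zero_imp_unit[of g n "()"]
    by (auto simp: Units_def ring_mat_simps)
  then have "Units (ring_mat TYPE(complex) n ()) = {g \<in> carrier_mat n n. det g \<noteq> 0}"
    by (intro Set.set_eqI) simp
  then show ?thesis by (simp add: GL_def units_of_def)
qed

lemma mem_Borel: "b \<in> Borel n \<longleftrightarrow> b \<in> carrier_mat n n \<and> det b \<noteq> 0 \<and> upper_triangular b"
  by (auto simp: Borel_def carrier_GL)

lemma flag_eq: "flag n g = (\<lambda>b. g * b) ` Borel n"
proof -
  have "mult (GL n) = (*)" by (simp add: GL_def units_of_def ring_mat_simps)
  then show ?thesis by (simp add: flag_def l_coset_def UNION_singleton_eq_range)
qed

lemma Borel_one: "1\<^sub>m n \<in> Borel n"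
  by (simp add: mem_Borel)

lemma Borel_mult: "a \<in> Borel n \<Longrightarrow> b \<in> Borel n \<Longrightarrow> a * b \<in> Borel n"
  using upper_triangular_mult[of a n b] det_mult[of a n b] mult_carrier_mat[of a n n b n]
  by (simp add: mem_Borel)

lemma Borel_inverse:
  assumes "b \<in> Borel n" obtains c where "c \<in> Borel n" "b * c = 1\<^sub>m n"
proof -
  have b: "b \<in> carrier_mat n n" "det b \<noteq> 0" "upper_triangular b" using assms by (auto simp: mem_Borel)
  obtain c where c: "c \<in> carrier_mat n n" "b * c = 1\<^sub>m n" using inverse_matE[OF b(1,2)] by blast
  moreover have "det c \<noteq> 0" using det_mult[OF b(1) c(1)] c(2) by (metis det_one mult_zero_right zero_neq_one)
  ultimately show thesis
    using that[of c] upper_triangular_inverse(1)[OF b(1,3) c] by (simp add: mem_Borel)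
qed

lemma flag_mult_Borel:
  assumes g: "g \<in> carrier_mat n n" and b: "b \<in> Borel n"
  shows "flag n (g * b) = flag n g"
proof -
  obtain c where c: "c \<in> Borel n" "b * c = 1\<^sub>m n" using Borel_inverse[OF b] .
  have BC: "x \<in> carrier_mat n n" if "x \<in> Borel n" for x using that by (simp add: mem_Borel)
  have "g * b * x \<in> (\<lambda>b. g * b) ` Borel n" if "x \<in> Borel n" for x
    using assoc_mult_mat[OF g BC[OF b] BC[OF that]] Borel_mult[OF b that] by simp
  moreover have "g * x \<in> (\<lambda>x. g * b * x) ` Borel n" if x: "x \<in> Borel n" for x
  proof (rule image_eqI)
    have "g * b * (c * x) = g * (b * (c * x))"
      by (rule assoc_mult_mat[OF g BC[OF b] mult_carrier_mat[OF BC[OF c(1)] BC[OF x]]])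
    also have "b * (c * x) = b * c * x"
      by (rule assoc_mult_mat[OF BC[OF b] BC[OF c(1)] BC[OF x], symmetric])
    finally show "g * x = g * b * (c * x)" using c BC[OF x] by simp
  qed (rule Borel_mult[OF c(1) x])
  ultimately show ?thesis by (auto simp: flag_eq)
qed

text \<open>The coset of \<open>h\<close> contains \<open>h\<close> itself, as the Borel group
  contains the identity.\<close>

lemma flag_eqD:
  assumes h: "h \<in> carrier_mat n n" and eq: "flag n g = flag n h"
  obtains b where "b \<in> Borel n" "h = g * b"
proof -
  have "h * 1\<^sub>m n \<in> flag n h" unfolding flag_eq using Borel_one by (rule imageI)
  then show thesis using that h unfolding eq[symmetric] by (auto simp: flag_eq)
qed

lemma real_flag_mult_upper_triangular:
  assumes A: "A \<in> carrier_mat n n" and U: "U \<in> carrier_mat n n" "upper_triangular U"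
    and pos: "\<And>i. i < n \<Longrightarrow> U $$ (i, i) > 0"
  shows "real_flag n (A * U) = real_flag n A"
proof -
  have "det U > 0" using U pos by (auto simp: det_upper_triangular_prod intro!: prod_pos)
  then have "map_mat complex_of_real U \<in> Borel n"
    using U by (auto simp: mem_Borel upper_triangular_def)
  then show ?thesis
    using A U by (simp add: real_flag_def of_real_hom.mat_hom_mult[of _ n n _ n] flag_mult_Borel)
qed

lemma GL_pos_left_pos:
  assumes "h \<in> GL_pos n" shows "h \<in> carrier_mat n n" "left_pos n h"
proof -
  show h: "h \<in> carrier_mat n n" using assms unfolding GL_pos_def by blast
  show "left_pos n h"
    unfolding left_pos_def
  proof (intro allI impI)
    fix k r assume r: "increasing k n r"
    then have "sub_det h k r id = minor h (r ` {..<k}) {..<k}"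
      using sub_det_eq_minor[OF h r increasing_id[of k n]] increasing_le[OF r] by simp
    moreover have "card (r ` {..<k}) = card {..<k}" "r ` {..<k} \<subseteq> {..<n}" "{..<k} \<subseteq> {..<n}"
      using r increasing_le[OF r] by (auto simp: card_image increasing_inj increasing_def)
    ultimately show "sub_det h k r id > 0" using assms unfolding GL_pos_def by simp
  qed
qed

text \<open>In both directions the representative changes only by upper triangular right factors
  with positive diagonal, which preserve the flag: \<open>R\<close> in one case, \<open>U\<close>
  and \<open>transpose_mat L\<close> in the other.\<close>

lemma Fl_pos_eq: "Fl_pos n = real_flag n ` orth_pos n"
proof (intro equalityI subsetI)
  fix V assume "V \<in> Fl_pos n"
  then obtain h where h: "h \<in> GL_pos n" "V = real_flag n h" by (auto simp: Fl_pos_def)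
  note hC = GL_pos_left_pos[OF h(1)]
  obtain Q R where Q: "Q \<in> carrier_mat n n" "transpose_mat Q * Q = 1\<^sub>m n"
    and R: "R \<in> carrier_mat n n" "upper_triangular R" "\<And>i. i < n \<Longrightarrow> R $$ (i, i) > 0" and QR: "h = Q * R"
    using left_pos_QR[OF hC] by blast
  have "left_pos n Q" using hC(2) left_pos_mult_upper_triangular[OF Q(1) R] by (simp add: QR)
  then have "Q \<in> orth_pos n" using Q by (simp add: orth_pos_def)
  moreover have "V = real_flag n Q" using h(2) real_flag_mult_upper_triangular[OF Q(1) R] by (simp add: QR)
  ultimately show "V \<in> real_flag n ` orth_pos n" by simp
next
  fix V assume "V \<in> real_flag n ` orth_pos n"
  then obtain Q where Q: "Q \<in> carrier_mat n n" "left_pos n Q" and V: "V = real_flag n Q"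
    by (auto simp: orth_pos_def)
  obtain L U where L: "lower_tri n L" "left_pos n L" "\<And>i. i < n \<Longrightarrow> L $$ (i, i) = 1"
    and U: "U \<in> carrier_mat n n" "upper_triangular U" "\<And>i. i < n \<Longrightarrow> U $$ (i, i) > 0"
    and LU: "Q = L * U"
    using left_pos_LU[OF Q] by blast
  have LC: "L \<in> carrier_mat n n" using L by (simp add: lower_tri_def)
  have "upper_triangular (transpose_mat L)"
    using L LC by (intro upper_triangularI) (auto simp: lower_tri_def)
  then have "real_flag n (L * transpose_mat L) = real_flag n L"
    using LC L by (intro real_flag_mult_upper_triangular) auto
  then have "V = real_flag n (L * transpose_mat L)"
    using real_flag_mult_upper_triangular[OF LC U] by (simp add: V LU)
  then show "V \<in> Fl_pos n"
    using lower_tri_mult_transpose_GL_pos[OF L(1,2)] by (simp add: Fl_pos_def)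
qed

subsection \<open>Orthogonal representatives\<close>

definition orth_nonneg :: "nat \<Rightarrow> real mat set" where
  "orth_nonneg n = {Q \<in> carrier_mat n n. transpose_mat Q * Q = 1\<^sub>m n \<and>
     (\<forall>k r. increasing k n r \<longrightarrow> sub_det Q k r id \<ge> 0)}"

lemma orthogonal_rep_iff: "orthogonal_rep n V g \<longleftrightarrow> g \<in> orth_nonneg n \<and> real_flag n g = V"
proof -
  have "(\<forall>I \<subseteq> {..<n}. minor g I {..<card I} \<ge> 0) \<longleftrightarrow> (\<forall>k r. increasing k n r \<longrightarrow> sub_det g k r id \<ge> 0)"
    if g: "g \<in> carrier_mat n n"
  proof (intro iffI allI impI)
    fix k r assume minors: "\<forall>I \<subseteq> {..<n}. minor g I {..<card I} \<ge> 0" and r: "increasing k n r"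
    have "sub_det g k r id = minor g (r ` {..<k}) {..<k}"
      using sub_det_eq_minor[OF g r increasing_id[of k n]] increasing_le[OF r] by simp
    moreover have "card (r ` {..<k}) = k" "r ` {..<k} \<subseteq> {..<n}"
      using r by (auto simp: card_image increasing_inj increasing_def)
    ultimately show "sub_det g k r id \<ge> 0" using minors[rule_format, of "r ` {..<k}"] by simp
  next
    fix I assume dets: "\<forall>k r. increasing k n r \<longrightarrow> sub_det g k r id \<ge> 0" and I: "I \<subseteq> {..<n}"
    have incr: "increasing (card I) n (pick I)" by (rule increasing_pick[OF I])
    have "minor g I {..<card I} = sub_det g (card I) (pick I) (pick {..<card I})"
      using increasing_le[OF incr] by (intro minor_eq_sub_det[OF g I]) auto
    also have "\<dots> = sub_det g (card I) (pick I) id"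
      by (rule sub_det_cong) (auto simp: pick_lessThan)
    finally show "minor g I {..<card I} \<ge> 0" using dets incr by simp
  qed
  then show ?thesis by (auto simp: orthogonal_rep_def orth_nonneg_def)
qed

lemma orth_pos_subset: "orth_pos n \<subseteq> orth_nonneg n"
  by (auto simp: orth_pos_def orth_nonneg_def left_pos_def less_imp_le)

lemma orthogonal_transpose:
  fixes Q :: "real mat"
  assumes "Q \<in> carrier_mat n n" "transpose_mat Q * Q = 1\<^sub>m n" shows "Q * transpose_mat Q = 1\<^sub>m n"
  using mat_mult_left_right_inverse[of "transpose_mat Q" n Q] assms by simp

text \<open>The inverse of an upper triangular matrix is upper triangular; here it is
  \<open>transpose_mat B\<close>, so \<open>B\<close> is diagonal and its diagonal entries square to
  1.\<close>

lemma orthogonal_upper_triangular_diagonal: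
  fixes B :: "real mat"
  assumes B: "B \<in> carrier_mat n n" "upper_triangular B" and BB: "B * transpose_mat B = 1\<^sub>m n"
  shows "\<And>i j. i < n \<Longrightarrow> j < n \<Longrightarrow> i \<noteq> j \<Longrightarrow> B $$ (i, j) = 0" "\<And>i. i < n \<Longrightarrow> (B $$ (i, i))\<^sup>2 = 1"
proof -
  have BT: "transpose_mat B \<in> carrier_mat n n" using B by simp
  note inv = upper_triangular_inverse[OF B BT BB]
  show "B $$ (i, j) = 0" if ij: "i < n" "j < n" "i \<noteq> j" for i j
  proof (cases "j < i")
    case True
    then show ?thesis using upper_triangular_below[OF B] ij by simp
  next
    case False
    then have "transpose_mat B $$ (j, i) = 0" using upper_triangular_below[OF BT inv(1)] ij by simp
    then show ?thesis using B ij by simp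
  qed
  show "(B $$ (i, i))\<^sup>2 = 1" if i: "i < n" for i
  proof -
    have "1 = (B * transpose_mat B) $$ (i, i)" using BB i by simp
    also have "\<dots> = (\<Sum>x<n. B $$ (i, x) * transpose_mat B $$ (x, i))"
      using B BT i by (intro index_mult_mat_sum[of _ n n _ n])
    also have "\<dots> = (\<Sum>x<n. if x = i then (B $$ (i, i))\<^sup>2 else 0)"
      using B i \<open>\<And>i j. i < n \<Longrightarrow> j < n \<Longrightarrow> i \<noteq> j \<Longrightarrow> B $$ (i, j) = 0\<close>
      by (intro sum.cong) (auto simp: power2_eq_square)
    finally show ?thesis using i by simp
  qed
qed

text \<open>Two orthogonal representatives of one flag differ by an orthogonal upper triangular
  \<open>B\<close>, a diagonal matrix of signs; nonnegative minors force all signs to be 1.\<close>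

lemma orth_nonneg_unique:
  assumes Q: "Q \<in> orth_nonneg n" and Q': "Q' \<in> orth_nonneg n" and eq: "real_flag n Q = real_flag n Q'"
  shows "Q = Q'"
proof -
  have QC: "Q \<in> carrier_mat n n" "transpose_mat Q * Q = 1\<^sub>m n"
    and Q'C: "Q' \<in> carrier_mat n n" "transpose_mat Q' * Q' = 1\<^sub>m n"
    using Q Q' by (auto simp: orth_nonneg_def)
  note QQ = orthogonal_transpose[OF QC]
  let ?c = "map_mat complex_of_real"
  define B where "B = transpose_mat Q * Q'"
  have BC: "B \<in> carrier_mat n n" using QC Q'C by (simp add: B_def)
  have Q'_eq: "Q' = Q * B"
    using assoc_mult_mat[of Q n n "transpose_mat Q" n Q' n] QC Q'C QQ by (simp add: B_def)
  obtain b where b: "b \<in> Borel n" "?c Q' = ?c Q * b"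
    using flag_eqD[of "?c Q'" n "?c Q"] eq Q'C by (auto simp: real_flag_def)
  have bC: "b \<in> carrier_mat n n" "upper_triangular b" using b by (auto simp: mem_Borel)
  \<comment> \<open>The complexification of \<open>B\<close> is the Borel element \<open>b\<close>
    linking the two representatives, so \<open>B\<close> is upper triangular.\<close>
  have "?c B = ?c (transpose_mat Q) * (?c Q * b)"
    unfolding B_def b(2)[symmetric] using QC Q'C by (intro of_real_hom.mat_hom_mult[of _ n n _ n]) auto
  also have "\<dots> = ?c (transpose_mat Q) * ?c Q * b"
    using QC bC by (intro assoc_mult_mat[of _ n n _ n _ n, symmetric]) auto
  also have "?c (transpose_mat Q) * ?c Q = ?c (transpose_mat Q * Q)"
    using QC by (intro of_real_hom.mat_hom_mult[of _ n n _ n, symmetric]) auto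
  also have "\<dots> * b = b" using QC(2) bC by (simp add: of_real_hom.mat_hom_one)
  finally have "?c B = b" .
  have upper: "upper_triangular B"
  proof (rule upper_triangularI)
    fix i j assume ij: "j < i" "i < dim_row B"
    then have "complex_of_real (B $$ (i, j)) = ?c B $$ (i, j)" using BC by simp
    also have "\<dots> = 0" using \<open>?c B = b\<close> upper_triangular_below[OF bC] ij BC by simp
    finally show "B $$ (i, j) = 0" by simp
  qed
  have BTB: "transpose_mat B * B = 1\<^sub>m n"
  proof -
    have "transpose_mat B * B = transpose_mat Q' * (Q * (transpose_mat Q * Q'))"
      unfolding B_def using QC Q'C by (simp add: transpose_mult[of _ n n] assoc_mult_mat[of _ n n _ n _ n])
    also have "Q * (transpose_mat Q * Q') = Q'"
      using Q'_eq by (simp add: B_def)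
    finally show ?thesis using Q'C by simp
  qed
  note B_diag = orthogonal_upper_triangular_diagonal[OF BC upper orthogonal_transpose[OF BC BTB]]
  \<comment> \<open>The squares of the \<open>k\<close>-minors of \<open>Q\<close> in the first
    \<open>k\<close> columns sum to 1, so one of these minors is nonzero, hence positive. The
    corresponding minor of \<open>Q'\<close> is nonnegative and equals this one times the diagonal
    product.\<close>
  have prod_pos: "(\<Prod>i<k. B $$ (i, i)) > 0" if k: "k \<le> n" for k
  proof -
    have "(\<Sum>K | K \<subseteq> {..<n} \<and> card K = k. (sub_det Q k (pick K) id)\<^sup>2) = sub_det (1\<^sub>m n :: real mat) k id id"
      using sub_det_gram[OF QC(1) k] QC(2) by simp
    also have "\<dots> = det (1\<^sub>m k :: real mat)"
      unfolding sub_det_def using k by (intro arg_cong[where f = det] eq_matI) auto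
    also have "\<dots> \<noteq> 0" by simp
    finally obtain K where K: "K \<subseteq> {..<n}" "card K = k" "sub_det Q k (pick K) id \<noteq> 0"
      by (auto elim: sum.not_neutral_contains_not_neutral)
    then have r: "increasing k n (pick K)" using increasing_pick[of K n] by simp
    have "sub_det Q k (pick K) id > 0"
      using K(3) r Q unfolding orth_nonneg_def by (simp add: less_le)
    moreover have "sub_det Q' k (pick K) id \<ge> 0" using r Q' by (simp add: orth_nonneg_def)
    moreover have "sub_det Q' k (pick K) id = sub_det Q k (pick K) id * (\<Prod>i<k. B $$ (i, i))"
      unfolding Q'_eq using QC BC upper r k
      by (intro sub_det_mult_upper_triangular) (auto simp: increasing_less)
    ultimately have "(\<Prod>i<k. B $$ (i, i)) \<ge> 0" by (simp add: zero_le_mult_iff)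
    moreover have "(\<Prod>i<k. B $$ (i, i)) \<noteq> 0"
    proof -
      have "B $$ (i, i) \<noteq> 0" if "i < k" for i using B_diag(2)[of i] that k by auto
      then show ?thesis by simp
    qed
    ultimately show ?thesis unfolding less_le by metis
  qed
  have "B $$ (i, i) = 1" if i: "i < n" for i
  proof -
    \<comment> \<open>The entry is a quotient of consecutive diagonal products.\<close>
    have "B $$ (i, i) > 0"
      using prod_pos[of i] prod_pos[of "Suc i"] i by (simp add: zero_less_mult_iff)
    then show ?thesis using B_diag(2)[OF i] by (simp add: power2_eq_1_iff)
  qed
  then have "B = 1\<^sub>m n" using BC B_diag(1) by (intro eq_matI) auto
  then show ?thesis using Q'_eq QC by simp
qed

section \<open>Matrix entries and the compact closure of the positive representatives\<close>

definition entries :: "nat \<Rightarrow> 'a::zero mat \<Rightarrow> nat \<times> nat \<Rightarrow> 'a" where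
  "entries n A = (\<lambda>ij. if ij \<in> {..<n} \<times> {..<n} then A $$ ij else 0)"

lemma mat_entries: "A \<in> carrier_mat n n \<Longrightarrow> mat n n (entries n A) = A"
  by (intro eq_matI) (auto simp: entries_def)

text \<open>Continuous maps translate between functions restricted to the index square and functions
  padded with 0 on all of \<open>nat \<times> nat\<close>. The latter form a full type, on which
  \<open>open\<close>, \<open>closure\<close> and \<open>compact\<close> apply.\<close>

lemma openin_GL_topology:
  "openin (GL_topology n) S \<longleftrightarrow> (\<exists>U. open U \<and> S = {g \<in> carrier (GL n). entries n g \<in> U})"
proof
  let ?I = "{..<n} \<times> {..<n}"
  let ?T = "product_topology (\<lambda>_. euclidean :: complex topology) ?I"
  {
    assume "openin (GL_topology n) S"
    then obtain V where V: "openin ?T V" "S = (\<lambda>A. restrict (\<lambda>ij. A $$ ij) ?I) -` V \<inter> carrier (GL n)"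
      by (auto simp: GL_topology_def openin_pullback_topology)
    have "continuous_map euclidean ?T (\<lambda>f :: nat \<times> nat \<Rightarrow> complex. restrict f ?I)"
      by (auto simp: continuous_map_componentwise)
    then have "open {f. restrict f ?I \<in> V}"
      using openin_continuous_map_preimage[OF _ V(1)] by fastforce
    moreover have "S = {g \<in> carrier (GL n). entries n g \<in> {f. restrict f ?I \<in> V}}"
    proof -
      have "restrict (entries n g) ?I = restrict (\<lambda>ij. g $$ ij) ?I" for g :: "complex mat"
        by (auto simp: entries_def fun_eq_iff)
      then show ?thesis using V(2) by auto
    qed
    ultimately show "\<exists>U. open U \<and> S = {g \<in> carrier (GL n). entries n g \<in> U}" by blast
  }
  {
    assume "\<exists>U. open U \<and> S = {g \<in> carrier (GL n). entries n g \<in> U}"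
    then obtain U where U: "open U" "S = {g \<in> carrier (GL n). entries n g \<in> U}" by blast
    let ?e = "\<lambda>(f :: nat \<times> nat \<Rightarrow> complex) ij. if ij \<in> ?I then f ij else 0"
    have "continuous_map ?T (product_topology (\<lambda>_. euclidean) UNIV) ?e"
      unfolding continuous_map_componentwise_UNIV
    proof
      fix k
      show "continuous_map ?T euclidean (\<lambda>f. ?e f k)"
        by (cases "k \<in> ?I") (auto intro: continuous_map_product_projection)
    qed
    then have "continuous_map ?T euclidean ?e" by (simp add: euclidean_product_topology)
    then have "openin ?T {f \<in> topspace ?T. ?e f \<in> U}"
      using U(1) openin_continuous_map_preimage by fastforce
    moreover have "S = (\<lambda>A. restrict (\<lambda>ij. A $$ ij) ?I) -` {f \<in> topspace ?T. ?e f \<in> U} \<inter> carrier (GL n)"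
    proof -
      have "?e (restrict (\<lambda>ij. g $$ ij) ?I) = entries n g" for g :: "complex mat"
        by (auto simp: entries_def fun_eq_iff)
      then show ?thesis using U(2) by auto
    qed
    ultimately show "openin (GL_topology n) S"
      unfolding GL_topology_def openin_pullback_topology by blast
  }
qed

text \<open>By the Leibniz formula a minor is a polynomial in the entries.\<close>

lemma continuous_on_sub_det:
  "continuous_on S (\<lambda>f :: nat \<times> nat \<Rightarrow> real. sub_det (mat n n f) k r c)"
  if "\<And>i. i < k \<Longrightarrow> r i < n" "\<And>i. i < k \<Longrightarrow> c i < n"
proof -
  have coord: "continuous_on S (\<lambda>f :: nat \<times> nat \<Rightarrow> real. f p)" for p
    by (rule continuous_on_subset[OF continuous_on_product_coordinates subset_UNIV])
  have "sub_det (mat n n f) k r c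
      = (\<Sum>p | p permutes {0..<k}. signof p * (\<Prod>i = 0..<k. f (r i, c (p i))))" for f :: "nat \<times> nat \<Rightarrow> real"
    unfolding sub_det_def using that
    by (subst det_def'[of _ k]) (auto intro!: sum.cong prod.cong simp: permutes_lt)
  then show ?thesis by (simp add: continuous_intros coord)
qed

text \<open>Defined as a closure rather than by weak inequalities, so that approximation by matrices
  in \<open>orth_pos\<close> is built in.\<close>

definition orth_pos_closure :: "nat \<Rightarrow> (nat \<times> nat \<Rightarrow> real) set" where
  "orth_pos_closure n = closure (entries n ` orth_pos n)"

lemma orthogonal_iff_sum:
  fixes f :: "nat \<times> nat \<Rightarrow> real"
  shows "transpose_mat (mat n n f) * mat n n f = 1\<^sub>m n \<longleftrightarrow>
    (\<forall>i<n. \<forall>j<n. (\<Sum>x<n. f (x, i) * f (x, j)) = (if i = j then 1 else 0))"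
proof -
  have "(transpose_mat (mat n n f) * mat n n f) $$ (i, j) = (\<Sum>x<n. f (x, i) * f (x, j))"
    if "i < n" "j < n" for i j
    using that by (subst index_mult_mat_sum[of _ n n _ n]) auto
  then show ?thesis
    by (auto simp: mat_eq_iff simp del: index_mult_mat(1))
qed

text \<open>Vanishing outside the index square, orthogonality and nonnegative minors are closed
  conditions on the entries, and all of them hold on \<open>orth_pos\<close>.\<close>

lemma orth_pos_closure_properties:
  assumes "f \<in> orth_pos_closure n"
  shows "mat n n f \<in> orth_nonneg n" "\<And>ij. ij \<notin> {..<n} \<times> {..<n} \<Longrightarrow> f ij = 0"
proof -
  have coord: "continuous_on UNIV (\<lambda>f :: nat \<times> nat \<Rightarrow> real. f p)" for p
    by (rule continuous_on_product_coordinates)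
  let ?N1 = "{f :: nat \<times> nat \<Rightarrow> real. \<forall>ij. ij \<notin> {..<n} \<times> {..<n} \<longrightarrow> f ij = 0}"
  let ?N2 = "{f :: nat \<times> nat \<Rightarrow> real. \<forall>i j. i < n \<longrightarrow> j < n \<longrightarrow> (\<Sum>x<n. f (x, i) * f (x, j)) = (if i = j then 1 else 0)}"
  let ?N3 = "{f :: nat \<times> nat \<Rightarrow> real. \<forall>k r. increasing k n r \<longrightarrow> 0 \<le> sub_det (mat n n f) k r id}"
  have "closed ?N1"
    by (intro closed_Collect_all closed_Collect_imp closed_Collect_eq coord continuous_intros) auto
  moreover have "closed ?N2"
    by (intro closed_Collect_all closed_Collect_imp closed_Collect_eq coord continuous_intros) auto
  moreover have "closed ?N3"
  proof (intro closed_Collect_all)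
    fix k r
    show "closed {f :: nat \<times> nat \<Rightarrow> real. increasing k n r \<longrightarrow> 0 \<le> sub_det (mat n n f) k r id}"
    proof (cases "increasing k n r")
      case True
      then have "continuous_on UNIV (\<lambda>f :: nat \<times> nat \<Rightarrow> real. sub_det (mat n n f) k r id)"
        using increasing_less[OF True] increasing_le[OF True] by (intro continuous_on_sub_det) auto
      then show ?thesis using True by (simp add: closed_Collect_le)
    qed simp
  qed
  ultimately have "closed (?N1 \<inter> ?N2 \<inter> ?N3)" by (intro closed_Int)
  moreover have "entries n ` orth_pos n \<subseteq> ?N1 \<inter> ?N2 \<inter> ?N3"
  proof (rule image_subsetI)
    fix Q assume "Q \<in> orth_pos n"
    then have Q: "Q \<in> carrier_mat n n" "transpose_mat Q * Q = 1\<^sub>m n" "left_pos n Q"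
      by (auto simp: orth_pos_def)
    have "entries n Q \<in> ?N2"
      using Q(2) orthogonal_iff_sum[of n "entries n Q"] by (simp add: mat_entries[OF Q(1)])
    moreover have "entries n Q \<in> ?N3"
      using Q(3) by (simp add: mat_entries[OF Q(1)] left_pos_def less_imp_le)
    moreover have "entries n Q \<in> ?N1" by (auto simp: entries_def)
    ultimately show "entries n Q \<in> ?N1 \<inter> ?N2 \<inter> ?N3" by blast
  qed
  ultimately have "orth_pos_closure n \<subseteq> ?N1 \<inter> ?N2 \<inter> ?N3"
    unfolding orth_pos_closure_def by (intro closure_minimal)
  then have f: "f \<in> ?N1" "f \<in> ?N2" "f \<in> ?N3" using assms by auto
  then show "mat n n f \<in> orth_nonneg n"
    using orthogonal_iff_sum[of n f] by (simp add: orth_nonneg_def)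
  show "f ij = 0" if "ij \<notin> {..<n} \<times> {..<n}" for ij using f(1) that by blast
qed

text \<open>The columns have norm 1, so all entries lie in \<open>{-1..1}\<close>, and the product
  of these intervals is compact by Tychonoff's theorem.\<close>

lemma compact_orth_pos_closure: "compact (orth_pos_closure n)"
proof -
  let ?B = "PiE UNIV (\<lambda>_ :: nat \<times> nat. {-1..1 :: real})"
  have "compactin (product_topology (\<lambda>_. euclidean) UNIV) ?B"
    unfolding compactin_PiE by (intro disjI2 ballI) simp
  then have "compact ?B" by (simp add: euclidean_product_topology)
  moreover have "orth_pos_closure n \<subseteq> ?B"
  proof
    fix f assume f: "f \<in> orth_pos_closure n"
    have "\<bar>f ij\<bar> \<le> 1" for ij
    proof (cases "ij \<in> {..<n} \<times> {..<n}")
      case True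
      then obtain i j where ij: "ij = (i, j)" "i < n" "j < n" by auto
      have "(f (i, j))\<^sup>2 \<le> (\<Sum>x<n. f (x, j) * f (x, j))"
        using ij member_le_sum[of i "{..<n}" "\<lambda>x. f (x, j) * f (x, j)"] by (simp add: power2_eq_square)
      also have "\<dots> = 1"
        using orth_pos_closure_properties(1)[OF f] ij orthogonal_iff_sum[of n f]
        by (simp add: orth_nonneg_def)
      finally show ?thesis using ij by (simp add: abs_square_le_1)
    qed (use orth_pos_closure_properties(2)[OF f] in simp)
    then show "f \<in> ?B" by (auto simp: abs_le_iff minus_le_iff)
  qed
  moreover have "closed (orth_pos_closure n)" by (simp add: orth_pos_closure_def)
  ultimately have "compact (?B \<inter> orth_pos_closure n)" by (intro compact_Int_closed)
  moreover have "?B \<inter> orth_pos_closure n = orth_pos_closure n"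
    using \<open>orth_pos_closure n \<subseteq> ?B\<close> by blast
  ultimately show ?thesis by simp
qed

subsection \<open>The twist map\<close>

text \<open>The condition says that \<open>f\<^sup>T h\<close> is upper triangular, that is, that the orthogonal matrix \<open>f\<close>
  represents the flag of \<open>h\<close>.\<close>

lemma closed_upper_triangular_condition:
  "closed {h :: nat \<times> nat \<Rightarrow> complex. \<exists>f \<in> orth_pos_closure n. \<forall>i j. j < i \<longrightarrow> i < n \<longrightarrow>
     (\<Sum>x<n. complex_of_real (f (x, i)) * h (x, j)) = 0}" (is "closed ?C")
proof -
  let ?Q = "orth_pos_closure n"
  let ?T = "{p :: (nat \<times> nat \<Rightarrow> real) \<times> (nat \<times> nat \<Rightarrow> complex). \<forall>i j. j < i \<longrightarrow> i < n \<longrightarrow>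
     (\<Sum>x<n. complex_of_real (fst p (x, i)) * snd p (x, j)) = 0}"
  have c1: "continuous_on UNIV (\<lambda>p :: (nat \<times> nat \<Rightarrow> real) \<times> (nat \<times> nat \<Rightarrow> complex). fst p ij)" for ij
    by (rule continuous_on_product_then_coordinatewise) (intro continuous_intros)
  have c2: "continuous_on UNIV (\<lambda>p :: (nat \<times> nat \<Rightarrow> real) \<times> (nat \<times> nat \<Rightarrow> complex). snd p ij)" for ij
    by (rule continuous_on_product_then_coordinatewise) (intro continuous_intros)
  have "closed ?T"
    by (intro closed_Collect_all closed_Collect_imp closed_Collect_eq c1 c2 continuous_intros) auto
  then have "closedin (top_of_set (?Q \<times> UNIV)) ((?Q \<times> UNIV) \<inter> ?T)"
    by (rule closedin_closed_Int)
  moreover have "prod_topology (top_of_set ?Q) euclidean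
      = top_of_set (?Q \<times> (UNIV :: (nat \<times> nat \<Rightarrow> complex) set))"
    by (simp add: prod_topology_subtopology(1))
  \<comment> \<open>\<open>?C\<close> is the projection of a closed set of pairs, and projection
    along a compact factor is a closed map.\<close>
  moreover have "compact_space (top_of_set ?Q)"
    using compact_orth_pos_closure by (simp add: compact_space_subtopology)
  then have "closed_map (prod_topology (top_of_set ?Q) (euclidean :: (nat \<times> nat \<Rightarrow> complex) topology)) euclidean snd"
    by (rule Abstract_Topological_Spaces.closed_map_snd)
  ultimately have "closedin euclidean (snd ` ((?Q \<times> UNIV) \<inter> ?T))"
    by (simp add: closed_map_def)
  moreover have "snd ` ((?Q \<times> UNIV) \<inter> ?T) = ?C"
  proof (intro subset_antisym subsetI)
    fix h assume "h \<in> ?C"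
    then obtain f where "(f, h) \<in> (?Q \<times> UNIV) \<inter> ?T" by auto
    then show "h \<in> snd ` ((?Q \<times> UNIV) \<inter> ?T)" by (intro image_eqI[of _ snd "(f, h)"]) simp_all
  next
    fix h assume "h \<in> snd ` ((?Q \<times> UNIV) \<inter> ?T)"
    then obtain f where "f \<in> ?Q" "(f, h) \<in> ?T" by fastforce
    then show "h \<in> ?C" by auto
  qed
  ultimately show ?thesis by simp
qed

section \<open>The nonnegative flags as images of the closure matrices\<close>

lemma complex_orthogonal:
  assumes "Q \<in> orth_nonneg n"
  defines "q \<equiv> map_mat complex_of_real Q"
  shows "q \<in> carrier (GL n)" "transpose_mat q * q = 1\<^sub>m n" "q * transpose_mat q = 1\<^sub>m n"
proof -
  have Q: "Q \<in> carrier_mat n n" "transpose_mat Q * Q = 1\<^sub>m n"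
    using assms by (auto simp: orth_nonneg_def)
  have q: "q \<in> carrier_mat n n" using Q by (simp add: q_def)
  have qT: "transpose_mat q = map_mat complex_of_real (transpose_mat Q)"
    using Q by (intro eq_matI) (auto simp: q_def)
  show "transpose_mat q * q = 1\<^sub>m n"
    unfolding qT unfolding q_def
    using Q of_real_hom.mat_hom_mult[of "transpose_mat Q" n n Q n, where 'a = complex]
    by (simp add: of_real_hom.mat_hom_one)
  then show "q * transpose_mat q = 1\<^sub>m n"
    using mat_mult_left_right_inverse[of "transpose_mat q" n q] q by simp
  then have "det q * det (transpose_mat q) = 1" using det_mult[of q n "transpose_mat q"] q by simp
  then have "det q \<noteq> 0" by (metis mult_zero_left zero_neq_one)
  then show "q \<in> carrier (GL n)" using q by (simp add: carrier_GL)
qed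

text \<open>For \<open>q\<close> the complexified \<open>Q\<close>, the only \<open>b\<close> with
  \<open>g = q * b\<close> is \<open>transpose_mat q * g\<close>. It is invertible, so it lies in
  the Borel group exactly when it is upper triangular.\<close>

lemma flag_eq_iff_upper_triangular:
  assumes Q: "Q \<in> orth_nonneg n" and g: "g \<in> carrier (GL n)"
  shows "flag n g = real_flag n Q \<longleftrightarrow> (\<forall>i j. j < i \<longrightarrow> i < n \<longrightarrow>
    (\<Sum>x<n. complex_of_real (Q $$ (x, i)) * g $$ (x, j)) = 0)" (is "_ \<longleftrightarrow> ?R")
proof -
  let ?q = "map_mat complex_of_real Q"
  have QC: "Q \<in> carrier_mat n n" using Q by (simp add: orth_nonneg_def)
  have q: "?q \<in> carrier_mat n n" "transpose_mat ?q \<in> carrier_mat n n" using QC by auto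
  note orth = complex_orthogonal[OF Q]
  have gC: "g \<in> carrier_mat n n" "det g \<noteq> 0" using g by (auto simp: carrier_GL)
  have qg: "transpose_mat ?q * g \<in> carrier_mat n n" using q gC by simp
  have "(transpose_mat ?q * g) $$ (i, j) = (\<Sum>x<n. complex_of_real (Q $$ (x, i)) * g $$ (x, j))"
    if "i < n" "j < n" for i j
    using that QC gC by (subst index_mult_mat_sum[OF q(2) gC(1)]) auto
  then have R: "?R \<longleftrightarrow> upper_triangular (transpose_mat ?q * g)"
    unfolding upper_triangular_def using qg QC by (auto simp del: index_mult_mat(1))
  show ?thesis
    unfolding R
  proof
    assume "flag n g = real_flag n Q"
    then obtain b where b: "b \<in> Borel n" "g = ?q * b"
      using flag_eqD[of g n ?q] gC by (auto simp: real_flag_def)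
    then have bC: "b \<in> carrier_mat n n" "upper_triangular b" by (auto simp: mem_Borel)
    have "transpose_mat ?q * g = transpose_mat ?q * ?q * b"
      unfolding b(2) by (rule assoc_mult_mat[OF q(2,1) bC(1), symmetric])
    then show "upper_triangular (transpose_mat ?q * g)" using orth bC by simp
  next
    assume upper: "upper_triangular (transpose_mat ?q * g)"
    have "det ?q \<noteq> 0" using orth(1) by (simp add: carrier_GL)
    then have "det (transpose_mat ?q * g) \<noteq> 0"
      using det_mult[OF q(2) gC(1)] det_transpose[OF q(1)] gC(2) by simp
    then have "transpose_mat ?q * g \<in> Borel n" using qg upper by (simp add: mem_Borel)
    moreover have "?q * (transpose_mat ?q * g) = g"
      using assoc_mult_mat[OF q gC(1)] orth(3) gC(1) by simp
    ultimately show "flag n g = real_flag n Q"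
      using flag_mult_Borel[OF q(1), of "transpose_mat ?q * g"] by (simp add: real_flag_def)
  qed
qed

lemma real_flag_in_Fl: "Q \<in> orth_nonneg n \<Longrightarrow> real_flag n Q \<in> Fl n"
  using complex_orthogonal(1) by (simp add: real_flag_def Fl_def)

text \<open>The image contains \<open>Fl_pos\<close> and is closed, as its preimage in the general
  linear group is cut out by a closed condition on the entries. Conversely, a neighbourhood of such
  a flag pulls back to a neighbourhood of its representative, which meets
  \<open>orth_pos\<close>.\<close>

lemma Fl_nonneg_eq: "Fl_nonneg n = (\<lambda>f. real_flag n (mat n n f)) ` orth_pos_closure n" (is "_ = ?F")
proof
  let ?C = "{h :: nat \<times> nat \<Rightarrow> complex. \<exists>f \<in> orth_pos_closure n. \<forall>i j. j < i \<longrightarrow> i < n \<longrightarrow>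
     (\<Sum>x<n. complex_of_real (f (x, i)) * h (x, j)) = 0}"
  have mem: "flag n g \<in> ?F \<longleftrightarrow> entries n g \<in> ?C" if g: "g \<in> carrier (GL n)" for g
  proof -
    have "flag n g = real_flag n (mat n n f) \<longleftrightarrow> (\<forall>i j. j < i \<longrightarrow> i < n \<longrightarrow>
        (\<Sum>x<n. complex_of_real (f (x, i)) * entries n g (x, j)) = 0)" if "f \<in> orth_pos_closure n" for f
      using flag_eq_iff_upper_triangular[OF orth_pos_closure_properties(1)[OF that] g]
      by (simp add: entries_def)
    then show ?thesis unfolding image_iff mem_Collect_eq by blast
  qed
  have F_sub: "?F \<subseteq> Fl n"
    using orth_pos_closure_properties(1) real_flag_in_Fl by blast
  have "openin (GL_topology n) {g \<in> carrier (GL n). flag n g \<in> Fl n - ?F}"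
    unfolding openin_GL_topology
  proof (intro exI conjI)
    show "open (- ?C)" using closed_upper_triangular_condition[of n] by (simp add: closed_def)
    show "{g \<in> carrier (GL n). flag n g \<in> Fl n - ?F} = {g \<in> carrier (GL n). entries n g \<in> - ?C}"
    proof (intro Collect_cong conj_cong refl)
      fix g assume g: "g \<in> carrier (GL n)"
      then have "flag n g \<in> Fl n" by (simp add: Fl_def)
      then show "flag n g \<in> Fl n - ?F \<longleftrightarrow> entries n g \<in> - ?C"
        using mem[OF g] by (simp only: Diff_iff Compl_iff simp_thms)
    qed
  qed
  then have "closedin (Fl_topology n) ?F"
    using F_sub by (simp add: closedin_def topspace_Fl_topology openin_Fl_topology)
  moreover have "Fl_pos n \<subseteq> ?F"
  proof
    fix V assume "V \<in> Fl_pos n"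
    then obtain Q where Q: "Q \<in> orth_pos n" "V = real_flag n Q" by (auto simp: Fl_pos_eq)
    then have "entries n Q \<in> orth_pos_closure n"
      unfolding orth_pos_closure_def using closure_subset by blast
    moreover have "mat n n (entries n Q) = Q" using Q by (simp add: mat_entries orth_pos_def)
    ultimately show "V \<in> ?F" using Q(2) by (intro image_eqI[of _ _ "entries n Q"]) simp_all
  qed
  ultimately show "Fl_nonneg n \<subseteq> ?F" unfolding Fl_nonneg_def by (intro closure_of_minimal)
next
  show "?F \<subseteq> Fl_nonneg n"
  proof (rule image_subsetI)
    fix f assume f: "f \<in> orth_pos_closure n"
    note N = orth_pos_closure_properties[OF f]
    let ?V = "real_flag n (mat n n f)"
    have "\<exists>W \<in> Fl_pos n. W \<in> T" if T: "?V \<in> T" "openin (Fl_topology n) T" for T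
    proof -
      have "openin (GL_topology n) {g \<in> carrier (GL n). flag n g \<in> T}"
        using T(2) by (simp add: openin_Fl_topology)
      then obtain U where U: "open U"
        "{g \<in> carrier (GL n). flag n g \<in> T} = {g \<in> carrier (GL n). entries n g \<in> U}"
        unfolding openin_GL_topology by blast
      let ?c = "\<lambda>(f :: nat \<times> nat \<Rightarrow> real) ij. complex_of_real (f ij)"
      have "continuous_on UNIV ?c"
        by (intro continuous_on_coordinatewise_then_product continuous_on_of_real
            continuous_on_product_coordinates)
      then have "open (?c -` U)" using U(1) by (simp add: continuous_on_open_vimage)
      moreover have entries_c: "?c (entries n A) = entries n (map_mat complex_of_real A)"
        if "A \<in> carrier_mat n n" for A
        using that by (auto simp: entries_def fun_eq_iff)
      have "entries n (mat n n f) = f" using N(2) by (auto simp: entries_def fun_eq_iff)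
      moreover have "map_mat complex_of_real (mat n n f) \<in> {g \<in> carrier (GL n). flag n g \<in> T}"
        using complex_orthogonal(1)[OF N(1)] T(1) by (simp add: real_flag_def)
      then have "entries n (map_mat complex_of_real (mat n n f)) \<in> U" unfolding U(2) by simp
      ultimately have "f \<in> ?c -` U" using entries_c[of "mat n n f"] by simp
      then have "?c -` U \<inter> entries n ` orth_pos n \<noteq> {}"
        using f \<open>open (?c -` U)\<close> unfolding orth_pos_closure_def by (meson disjoint_iff open_Int_closure_eq_empty)
      then obtain Q where Q: "Q \<in> orth_pos n" "?c (entries n Q) \<in> U" by auto
      have QN: "Q \<in> orth_nonneg n" using Q(1) orth_pos_subset by blast
      then have "entries n (map_mat complex_of_real Q) \<in> U"
        using Q(2) entries_c[of Q] by (simp add: orth_nonneg_def)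
      then have "real_flag n Q \<in> T"
        using U(2) complex_orthogonal(1)[OF QN] by (auto simp: real_flag_def)
      then show ?thesis using Q(1) by (auto simp: Fl_pos_eq)
    qed
    then show "?V \<in> Fl_nonneg n"
      unfolding Fl_nonneg_def in_closure_of topspace_Fl_topology
      using real_flag_in_Fl[OF N(1)] by blast
  qed
qed

section \<open>The twist on nonnegative flags\<close>

lemma orth_pos_closure_alternate_transpose:
  assumes f: "f \<in> orth_pos_closure n"
  shows "(\<lambda>(i, j). (- 1) ^ (i + j) * f (j, i)) \<in> orth_pos_closure n"
proof -
  let ?\<phi> = "\<lambda>(f :: nat \<times> nat \<Rightarrow> real) (i, j). (- 1) ^ (i + j) * f (j, i)"
  have "continuous_on UNIV (\<lambda>f. ?\<phi> f ij)" for ij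
    by (cases ij) (auto intro!: continuous_intros continuous_on_product_coordinates)
  then have "continuous_on UNIV ?\<phi>" by (intro continuous_on_coordinatewise_then_product)
  then have "continuous_on (closure (entries n ` orth_pos n)) ?\<phi>"
    by (rule continuous_on_subset) simp
  moreover have "?\<phi> ` (entries n ` orth_pos n) \<subseteq> orth_pos_closure n"
  proof (clarify)
    fix Q assume Q: "Q \<in> orth_pos n"
    then have "Q \<in> carrier_mat n n" by (simp add: orth_pos_def)
    \<comment> \<open>The zero padding is preserved, so on matrices \<open>?\<phi>\<close> is the
      transpose with alternating signs.\<close>
    then have "?\<phi> (entries n Q) = entries n (alternate n (transpose_mat Q))"
      by (auto simp: entries_def alternate_def fun_eq_iff)
    moreover have "entries n (alternate n (transpose_mat Q)) \<in> orth_pos_closure n"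
      using orth_pos_alternate_transpose[OF Q] closure_subset unfolding orth_pos_closure_def by blast
    ultimately show "?\<phi> (entries n Q) \<in> orth_pos_closure n" by simp
  qed
  ultimately have "?\<phi> ` closure (entries n ` orth_pos n) \<subseteq> orth_pos_closure n"
    by (intro image_closure_subset) (auto simp: orth_pos_closure_def)
  then show ?thesis using f unfolding orth_pos_closure_def by blast
qed

text \<open>Uniqueness of the orthogonal representative evaluates the \<open>THE\<close>,
  orthogonality turns the inverse into the transpose, and conjugation by \<open>delta n\<close> is
  \<open>alternate n\<close>.\<close>

lemma twist_eq:
  assumes Q: "Q \<in> orth_nonneg n"
  shows "twist n (real_flag n Q) = real_flag n (alternate n (transpose_mat Q))"
proof -
  have QC: "Q \<in> carrier_mat n n" "transpose_mat Q * Q = 1\<^sub>m n" using Q by (auto simp: orth_nonneg_def)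
  have "(THE g. orthogonal_rep n (real_flag n Q) g) = Q"
    using Q orth_nonneg_unique[of _ n Q] by (intro the_equality) (auto simp: orthogonal_rep_iff)
  moreover have "inv\<^bsub>ring_mat TYPE(real) n ()\<^esub> Q = transpose_mat Q"
  proof -
    interpret ring "ring_mat TYPE(real) n ()" by (rule ring_mat)
    show ?thesis
      using QC orthogonal_transpose[OF QC] by (intro inv_char) (simp_all add: ring_mat_simps)
  qed
  moreover have "delta n * transpose_mat Q * delta n = alternate n (transpose_mat Q)"
  proof -
    have left: "delta n * transpose_mat Q = mat n n (\<lambda>(i, j). (- 1) ^ i * transpose_mat Q $$ (i, j))"
      unfolding delta_def using QC by (intro mat_diag_mult_left) simp
    then have "delta n * transpose_mat Q \<in> carrier_mat n n" by simp
    then have "delta n * transpose_mat Q * delta n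
        = mat n n (\<lambda>(i, j). (delta n * transpose_mat Q) $$ (i, j) * (- 1) ^ j)"
      unfolding delta_def by (rule mat_diag_mult_right)
    then show ?thesis
      unfolding left by (intro eq_matI) (auto simp: alternate_def power_add)
  qed
  ultimately show ?thesis by (simp add: twist_def Let_def)
qed

lemma alternate_transpose_involution:
  "Q \<in> carrier_mat n n \<Longrightarrow> alternate n (transpose_mat (alternate n (transpose_mat Q))) = Q"
  by (simp add: alternate_transpose alternate_alternate)

theorem theorem1p2:
  fixes n :: nat
  shows
    "(\<forall>V \<in> Fl_nonneg n. \<exists>!g. orthogonal_rep n V g) \<and>
     (\<forall>V \<in> Fl_nonneg n. \<forall>g. orthogonal_rep n V g \<longrightarrow>
        twist n V = real_flag n (Matrix.mat n n (\<lambda>(i, j). (- 1) ^ (i + j) * g $$ (j, i)))) \<and>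
     (\<forall>V \<in> Fl_nonneg n. twist n V \<in> Fl_nonneg n \<and> twist n (twist n V) = V) \<and>
     (\<forall>V \<in> Fl_pos n. twist n V \<in> Fl_pos n \<and> twist n (twist n V) = V)"
proof (intro conjI ballI allI impI)
  fix V assume V: "V \<in> Fl_nonneg n"
  then obtain f where f: "f \<in> orth_pos_closure n" "V = real_flag n (mat n n f)"
    by (auto simp: Fl_nonneg_eq)
  define Q where "Q = mat n n f"
  have Q: "Q \<in> orth_nonneg n" "V = real_flag n Q"
    using f orth_pos_closure_properties(1) by (auto simp: Q_def)
  show "\<exists>!g. orthogonal_rep n V g"
    using Q orth_nonneg_unique[of _ n Q] by (auto simp: orthogonal_rep_iff)
  let ?g = "\<lambda>(i, j). (- 1) ^ (i + j) * f (j, i)"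
  have g: "?g \<in> orth_pos_closure n" by (rule orth_pos_closure_alternate_transpose[OF f(1)])
  have gQ: "mat n n ?g = alternate n (transpose_mat Q)"
    by (intro eq_matI) (auto simp: Q_def alternate_def)
  have twist_V: "twist n V = real_flag n (mat n n ?g)" by (simp add: Q twist_eq gQ)
  then show "twist n V \<in> Fl_nonneg n" using g by (auto simp: Fl_nonneg_eq)
  \<comment> \<open>The twisted matrix lies in the closure again, hence in
    \<open>orth_nonneg\<close>, so \<open>twist_eq\<close> applies a second time.\<close>
  have "twist n (twist n V) = real_flag n (alternate n (transpose_mat (mat n n ?g)))"
    unfolding twist_V by (rule twist_eq[OF orth_pos_closure_properties(1)[OF g]])
  then show "twist n (twist n V) = V"
    unfolding gQ using Q by (simp add: alternate_transpose_involution orth_nonneg_def)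
next
  fix V g assume "orthogonal_rep n V g"
  then have g: "g \<in> orth_nonneg n" "V = real_flag n g" by (auto simp: orthogonal_rep_iff)
  then have "alternate n (transpose_mat g) = mat n n (\<lambda>(i, j). (- 1) ^ (i + j) * g $$ (j, i))"
    by (intro eq_matI) (auto simp: alternate_def orth_nonneg_def)
  then show "twist n V = real_flag n (mat n n (\<lambda>(i, j). (- 1) ^ (i + j) * g $$ (j, i)))"
    using twist_eq[OF g(1)] g(2) by simp
next
  fix V assume "V \<in> Fl_pos n"
  then obtain Q where Q: "Q \<in> orth_pos n" "V = real_flag n Q" by (auto simp: Fl_pos_eq)
  \<comment> \<open>Passing to the closure yields only weak inequalities, so the strict case uses
    the twist on \<open>orth_pos\<close> directly.\<close>
  note Q' = orth_pos_alternate_transpose[OF Q(1)]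
  have twist_V: "twist n V = real_flag n (alternate n (transpose_mat Q))"
    using Q orth_pos_subset twist_eq by blast
  then show "twist n V \<in> Fl_pos n" using Q' by (simp add: Fl_pos_eq)
  have "twist n (twist n V) = real_flag n (alternate n (transpose_mat (alternate n (transpose_mat Q))))"
    unfolding twist_V using Q' orth_pos_subset twist_eq by blast
  then show "twist n (twist n V) = V"
    using Q by (simp add: alternate_transpose_involution orth_pos_def)
qed

end
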